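(* Every ($C_4$, prism)-free perfect graph is paw-friendly.
   Context: All graphs finite and simple. $C_4$ is the induced cycle on four vertices. A prism is two vertex-disjoint triangles $\{a_1,a_2,a_3\}$, $\{b_1,b_2,b_3\}$ with three vertex-disjoint induced paths $P_i$ from $a_i$ to $b_i$ such that for $i<j$ the only edges between $V(P_i)$ and $V(P_j)$ are $a_ia_j,b_ib_j$. A paw is the graph with vertices $v_1,\dots,v_4$ and edges $v_1v_2,v_2v_3,v_3v_4,v_2v_4$. For a graph $H$ and $X\subseteq V(H)$, $N_H[X]$ is $X$ together with all vertices of $H$ having a neighbor in $X$. For $Y\subseteq V(H)$ and $x\in V(H)\setminus Y$, $x$ breaks $Y$ (in $H$) if for every connected component $D$ of $H\setminus N_H[x]$, $Y\not\subseteq N_H[D]$. A graph $G$ is paw-friendly if $G$ is perfect and for every induced subgraph $H$ of $G$ and every induced paw in $H$ with vertex set $\{c,a,b_1,b_2\}$ and edge set $\{ab_1,ab_2,b_1b_2,ac\}$, either $a$ breaks $\{c,b_1,b_2\}$, or $b_1$ breaks $\{c,b_2\}$, or $b_2$ breaks $\{c,b_1\}$ (in $H$). *)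

theory Defs
  imports Main
begin

text \<open>A finite simple graph is given by a finite vertex set V and a symmetric,
irreflexive adjacency relation E. Induced subgraphs are given by subsets X of V
(with the adjacency relation E restricted to X).\<close>

definition simple_graph :: "'a set \<Rightarrow> ('a \<Rightarrow> 'a \<Rightarrow> bool) \<Rightarrow> bool" where
  "simple_graph V E \<longleftrightarrow> finite V \<and> (\<forall>u v. E u v \<longrightarrow> E v u) \<and> (\<forall>v. \<not> E v v)"

definition clique :: "('a \<Rightarrow> 'a \<Rightarrow> bool) \<Rightarrow> 'a set \<Rightarrow> bool" where
  "clique E K \<longleftrightarrow> (\<forall>u\<in>K. \<forall>v\<in>K. u \<noteq> v \<longrightarrow> E u v)"

definition clique_number :: "'a set \<Rightarrow> ('a \<Rightarrow> 'a \<Rightarrow> bool) \<Rightarrow> nat" where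
  "clique_number X E = Max {card K | K. K \<subseteq> X \<and> clique E K}"

definition proper_colouring :: "'a set \<Rightarrow> ('a \<Rightarrow> 'a \<Rightarrow> bool) \<Rightarrow> nat \<Rightarrow> ('a \<Rightarrow> nat) \<Rightarrow> bool" where
  "proper_colouring X E k f \<longleftrightarrow> (\<forall>v\<in>X. f v < k) \<and> (\<forall>u\<in>X. \<forall>v\<in>X. E u v \<longrightarrow> f u \<noteq> f v)"

definition chromatic_number :: "'a set \<Rightarrow> ('a \<Rightarrow> 'a \<Rightarrow> bool) \<Rightarrow> nat" where
  "chromatic_number X E = (LEAST k. \<exists>f. proper_colouring X E k f)"

definition perfect :: "'a set \<Rightarrow> ('a \<Rightarrow> 'a \<Rightarrow> bool) \<Rightarrow> bool" where
  "perfect V E \<longleftrightarrow> (\<forall>X\<subseteq>V. chromatic_number X E = clique_number X E)"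

definition C4_free :: "'a set \<Rightarrow> ('a \<Rightarrow> 'a \<Rightarrow> bool) \<Rightarrow> bool" where
  "C4_free V E \<longleftrightarrow> \<not> (\<exists>a\<in>V. \<exists>b\<in>V. \<exists>c\<in>V. \<exists>d\<in>V. distinct [a,b,c,d] \<and>
      E a b \<and> E b c \<and> E c d \<and> E d a \<and> \<not> E a c \<and> \<not> E b d)"

definition induced_path :: "('a \<Rightarrow> 'a \<Rightarrow> bool) \<Rightarrow> 'a list \<Rightarrow> bool" where
  "induced_path E p \<longleftrightarrow> p \<noteq> [] \<and> distinct p \<and>
     (\<forall>i<length p. \<forall>j<length p. E (p!i) (p!j) \<longleftrightarrow> (i = j + 1 \<or> j = i + 1))"

definition has_prism :: "'a set \<Rightarrow> ('a \<Rightarrow> 'a \<Rightarrow> bool) \<Rightarrow> bool" where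
  "has_prism V E \<longleftrightarrow> (\<exists>P :: nat \<Rightarrow> 'a list.
      (\<forall>i<3. induced_path E (P i) \<and> set (P i) \<subseteq> V) \<and>
      (\<forall>i<3. \<forall>j<3. i \<noteq> j \<longrightarrow> set (P i) \<inter> set (P j) = {}) \<and>
      {hd (P i) | i. i < 3} \<inter> {last (P i) | i. i < 3} = {} \<and>
      (\<forall>i<3. \<forall>j<3. i \<noteq> j \<longrightarrow> E (hd (P i)) (hd (P j)) \<and> E (last (P i)) (last (P j))) \<and>
      (\<forall>i<3. \<forall>j<3. i < j \<longrightarrow> (\<forall>x\<in>set (P i). \<forall>y\<in>set (P j).
          E x y \<longrightarrow> (x = hd (P i) \<and> y = hd (P j)) \<or> (x = last (P i) \<and> y = last (P j)))))"

definition prism_free :: "'a set \<Rightarrow> ('a \<Rightarrow> 'a \<Rightarrow> bool) \<Rightarrow> bool" where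
  "prism_free V E \<longleftrightarrow> \<not> has_prism V E"

definition closed_nbhd :: "'a set \<Rightarrow> ('a \<Rightarrow> 'a \<Rightarrow> bool) \<Rightarrow> 'a set \<Rightarrow> 'a set" where
  "closed_nbhd X E S = S \<union> {v\<in>X. \<exists>u\<in>S. E v u}"

definition component :: "'a set \<Rightarrow> ('a \<Rightarrow> 'a \<Rightarrow> bool) \<Rightarrow> 'a set \<Rightarrow> bool" where
  "component W E D \<longleftrightarrow> (\<exists>u\<in>W. D = {v. (\<lambda>x y. x \<in> W \<and> y \<in> W \<and> E x y)\<^sup>*\<^sup>* u v})"

definition breaks :: "'a set \<Rightarrow> ('a \<Rightarrow> 'a \<Rightarrow> bool) \<Rightarrow> 'a \<Rightarrow> 'a set \<Rightarrow> bool" where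
  "breaks X E x Y \<longleftrightarrow> Y \<subseteq> X \<and> x \<in> X - Y \<and>
     (\<forall>D. component (X - closed_nbhd X E {x}) E D \<longrightarrow> \<not> Y \<subseteq> closed_nbhd X E D)"

definition paw_friendly :: "'a set \<Rightarrow> ('a \<Rightarrow> 'a \<Rightarrow> bool) \<Rightarrow> bool" where
  "paw_friendly V E \<longleftrightarrow> perfect V E \<and>
     (\<forall>X\<subseteq>V. \<forall>c\<in>X. \<forall>a\<in>X. \<forall>b1\<in>X. \<forall>b2\<in>X.
        distinct [c, a, b1, b2] \<and> E a b1 \<and> E a b2 \<and> E b1 b2 \<and> E a c \<and>
        \<not> E c b1 \<and> \<not> E c b2 \<longrightarrow>
        breaks X E a {c, b1, b2} \<or> breaks X E b1 {c, b2} \<or> breaks X E b2 {c, b1})"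

end

(* Suppose that none of a, b1, b2 breaks its set. Let F be the component of c in H minus the closed
neighbourhoods of b1 and b2, and D a component of H minus N[a] attached to c, b1, b2. Both b1 and b2 have
private neighbours y1, y2 attached to F, so induced paths P from y1 to y2 through F close to even holes
with the edge b1 b2, and by prism-freeness every common neighbour of b1, b2 attached to F hits
every such P. Now consider how D leaves F.
If it does so at a common neighbour d of b1 and b2, then a and d are two nonadjacent hubs of the
hole, and a parity count leaves only the case that they hit P in opposite ends; then an induced path
from a to y2 in F is closed both by b2 and by d, b1, with holes of different parity.
If it leaves only through neighbours of b1, a path in D from such a neighbour to b2 yields four holes
whose parities contradict each other, or, if y2 touches that path, b1 and y2 are two hubs of one hole.
If it leaves at y1 and at y2, a path outside F in D between them forms a second hole with P, so a has
exactly two, adjacent, neighbours on P; this makes a a hub of the second hole, linked to it by b1,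
which gives a prism. *)

theory Submission
  imports Defs
begin

text \<open>A vertex outside \<open>F\<close> with a neighbour in \<open>F\<close> must see
  \<open>b1\<close> or \<open>b2\<close>, since otherwise it would belong to \<open>F\<close>; this
  is why the listed ways in which \<open>D\<close> leaves \<open>F\<close> are exhaustive. The
  private neighbours come from the failures of \<open>b1\<close> and \<open>b2\<close>: the
  component witnessing that \<open>b1\<close> does not break \<open>{c, b2}\<close> contains
  \<open>c\<close> and reaches \<open>b2\<close> while avoiding the neighbours of \<open>b1\<close>,
  and a shortest such path stays in \<open>F\<close> until it meets its first neighbour of
  \<open>b2\<close>. Perfection enters through even holes: a hole has no triangle, so perfection
  makes it 2-colourable. Parity alone cannot exclude configurations in which a vertex attaches to a
  hole in two consecutive vertices. These are where prisms appear, and \<open>hub_meets_hole\<close>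
  isolates them; it serves first with the base edge \<open>b1 b2\<close> and then with an edge
  formed by two neighbours of \<open>a\<close>. C4-freeness says that common neighbours of two
  nonadjacent vertices are pairwise adjacent: opposite private neighbours are therefore nonadjacent,
  and two nonadjacent hubs share no neighbour on \<open>P\<close> or in \<open>F\<close>.\<close>

lemma induced_path_Nil [simp]: "\<not> induced_path E []"
  by (simp add: induced_path_def)

section \<open>Induced paths: concatenation, reversal and shortest walks\<close>

locale ugraph =
  fixes E :: "'a \<Rightarrow> 'a \<Rightarrow> bool"
  assumes sym: "E x y \<Longrightarrow> E y x"
    and irrefl [simp]: "\<not> E x x"
begin

lemma sym_iff: "E x y \<longleftrightarrow> E y x"
  using sym by blast

lemma induced_path_single [simp]: "induced_path E [x]"
  by (simp add: induced_path_def)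

lemma induced_path_appendI:
  assumes p: "induced_path E p" and q: "induced_path E q" and d: "set p \<inter> set q = {}"
    and c: "\<And>x y. x \<in> set p \<Longrightarrow> y \<in> set q \<Longrightarrow> E x y \<longleftrightarrow> x = last p \<and> y = hd q"
  shows "induced_path E (p @ q)"
  unfolding induced_path_def
proof (intro conjI allI impI)
  have ne: "p \<noteq> []" "q \<noteq> []" and dp: "distinct p" and dq: "distinct q"
    using p q by (auto simp: induced_path_def)
  show "p @ q \<noteq> []" "distinct (p @ q)" using ne dp dq d by auto
  have cross: "E (p!i) (q!j) \<longleftrightarrow> i = length p - 1 \<and> j = 0" if "i < length p" "j < length q" for i j
  proof -
    have "p!i = last p \<longleftrightarrow> i = length p - 1"
      using that ne dp by (simp add: last_conv_nth nth_eq_iff_index_eq)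
    moreover have "q!j = hd q \<longleftrightarrow> j = 0"
      using that ne dq by (simp add: hd_conv_nth nth_eq_iff_index_eq)
    ultimately show ?thesis using c[of "p!i" "q!j"] that by simp
  qed
  fix i j assume i: "i < length (p @ q)" and j: "j < length (p @ q)"
  show "E ((p @ q) ! i) ((p @ q) ! j) = (i = j + 1 \<or> j = i + 1)"
  proof (cases "i < length p"; cases "j < length p")
    assume "i < length p" "j < length p"
    then show ?thesis using p by (simp add: induced_path_def nth_append)
  next
    assume "i < length p" "\<not> j < length p"
    then show ?thesis using cross[of i "j - length p"] j by (auto simp: nth_append)
  next
    assume "\<not> i < length p" "j < length p"
    then show ?thesis using cross[of j "i - length p"] i by (auto simp: nth_append sym_iff)
  next
    assume "\<not> i < length p" "\<not> j < length p"
    then show ?thesis using q i j by (auto simp: induced_path_def nth_append)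
  qed
qed

lemma induced_path_appendD:
  assumes pq: "induced_path E (p @ q)"
  shows "p \<noteq> [] \<Longrightarrow> induced_path E p" and "q \<noteq> [] \<Longrightarrow> induced_path E q"
    and "set p \<inter> set q = {}"
    and "x \<in> set p \<Longrightarrow> y \<in> set q \<Longrightarrow> E x y \<longleftrightarrow> x = last p \<and> y = hd q"
proof -
  have dist: "distinct p" "distinct q" "set p \<inter> set q = {}"
    using pq by (auto simp: induced_path_def)
  then show "set p \<inter> set q = {}" by simp
  have adj: "E ((p @ q) ! i) ((p @ q) ! j) = (i = j + 1 \<or> j = i + 1)"
    if "i < length p + length q" "j < length p + length q" for i j
    using pq that by (simp add: induced_path_def)
  have "E (p!i) (p!j) = (i = j + 1 \<or> j = i + 1)" if "i < length p" "j < length p" for i j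
    using adj[of i j] that by (simp add: nth_append)
  then show "p \<noteq> [] \<Longrightarrow> induced_path E p" using dist by (simp add: induced_path_def)
  have "E (q!i) (q!j) = (i = j + 1 \<or> j = i + 1)" if "i < length q" "j < length q" for i j
    using adj[of "length p + i" "length p + j"] that by (simp add: nth_append)
  then show "q \<noteq> [] \<Longrightarrow> induced_path E q" using dist by (simp add: induced_path_def)
  assume "x \<in> set p" "y \<in> set q"
  then obtain i j where ij: "i < length p" "x = p!i" "j < length q" "y = q!j"
    by (metis in_set_conv_nth)
  then have ne: "p \<noteq> []" "q \<noteq> []" by auto
  have "E x y \<longleftrightarrow> length p + j = i + 1"
    using adj[of i "length p + j"] ij by (simp add: nth_append)
  also have "\<dots> \<longleftrightarrow> i = length p - 1 \<and> j = 0" using ij by auto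
  also have "\<dots> \<longleftrightarrow> x = last p \<and> y = hd q"
    using ij ne dist by (simp add: last_conv_nth hd_conv_nth nth_eq_iff_index_eq)
  finally show "E x y \<longleftrightarrow> x = last p \<and> y = hd q" .
qed

lemma induced_path_append_iff:
  assumes "p \<noteq> []" "q \<noteq> []"
  shows "induced_path E (p @ q) \<longleftrightarrow> induced_path E p \<and> induced_path E q \<and> set p \<inter> set q = {} \<and>
    (\<forall>x\<in>set p. \<forall>y\<in>set q. E x y \<longleftrightarrow> x = last p \<and> y = hd q)"
  using assms induced_path_appendI[of p q] induced_path_appendD[of p q] by blast

lemma induced_path_Cons_iff:
  assumes "q \<noteq> []"
  shows "induced_path E (x # q) \<longleftrightarrow> induced_path E q \<and> x \<notin> set q \<and>
    (\<forall>y\<in>set q. E x y \<longleftrightarrow> y = hd q)"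
  using induced_path_append_iff[of "[x]" q] assms by auto

lemma induced_path_rev [simp]: "induced_path E (rev p) \<longleftrightarrow> induced_path E p"
proof -
  have *: "induced_path E (rev p)" if "induced_path E p" for p
    unfolding induced_path_def
  proof (intro conjI allI impI)
    show "rev p \<noteq> []" "distinct (rev p)" using that by (auto simp: induced_path_def)
    fix i j assume ij: "i < length (rev p)" "j < length (rev p)"
    have "E (p ! (length p - Suc i)) (p ! (length p - Suc j)) =
      (length p - Suc i = length p - Suc j + 1 \<or> length p - Suc j = length p - Suc i + 1)"
      using that ij by (simp add: induced_path_def)
    moreover have "rev p ! i = p ! (length p - Suc i)" "rev p ! j = p ! (length p - Suc j)"
      using ij by (simp_all add: rev_nth)
    moreover have "(length p - Suc i = length p - Suc j + 1 \<or> length p - Suc j = length p - Suc i + 1)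
        \<longleftrightarrow> (i = j + 1 \<or> j = i + 1)"
      using ij by (simp; linarith)
    ultimately show "E (rev p ! i) (rev p ! j) = (i = j + 1 \<or> j = i + 1)" by metis
  qed
  show ?thesis using *[of p] *[of "rev p"] by auto
qed

lemma induced_path_successively: "induced_path E p \<Longrightarrow> successively E p"
  by (simp add: induced_path_def successively_conv_nth)

text \<open>Take a shortest walk within \<open>set xs\<close> from an \<open>A\<close>-vertex to a
  \<open>B\<close>-vertex: a chord, a repetition, or an \<open>A\<close>- or \<open>B\<close>-vertex
  in the wrong place would allow a shorter one. With adjacency to a vertex z as \<open>A\<close> or
  \<open>B\<close>, the result is a path on which z sees exactly one end, ready to be closed to a
  hole.\<close>

lemma walk_imp_induced_path:
  assumes "successively E xs" "xs \<noteq> []" "A (hd xs)" "B (last xs)"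
  obtains ys where "induced_path E ys" "set ys \<subseteq> set xs"
    "\<forall>y\<in>set ys. A y \<longleftrightarrow> y = hd ys" "\<forall>y\<in>set ys. B y \<longleftrightarrow> y = last ys"
proof -
  let ?W = "\<lambda>ys. successively E ys \<and> ys \<noteq> [] \<and> A (hd ys) \<and> B (last ys) \<and> set ys \<subseteq> set xs"
  have "?W xs" using assms by simp
  then obtain ys where W: "?W ys" and min: "\<And>zs. ?W zs \<Longrightarrow> length ys \<le> length zs"
    using ex_has_least_nat[of ?W xs length] by blast
  have suc: "E (ys!i) (ys!Suc i)" if "Suc i < length ys" for i
    using W that by (simp add: successively_conv_nth)
  have cut: False if i: "i < length ys" and j: "j < length ys" and "Suc i < j" and e: "E (ys!i) (ys!j)" for i j
  proof -
    let ?z = "take (Suc i) ys @ drop j ys"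
    have "last (take (Suc i) ys) = ys!i" using i by (simp add: take_Suc_conv_app_nth)
    moreover have "successively E (take (Suc i) ys)" "successively E (drop j ys)"
      using W by (metis append_take_drop_id successively_append_iff)+
    ultimately have "successively E ?z" using j e by (simp add: successively_append_iff hd_drop_conv_nth)
    moreover have "hd ?z = hd ys" "last ?z = last ys" "?z \<noteq> []"
      using i j W by (auto simp: hd_conv_nth nth_append)
    moreover have "set ?z \<subseteq> set xs" using W set_take_subset[of "Suc i" ys] set_drop_subset[of j ys] by auto
    ultimately have "?W ?z" using W by metis
    then have "length ys \<le> length ?z" by (rule min)
    then show False using that by simp
  qed
  have noA: "i = 0" if i: "i < length ys" "A (ys!i)" for i
  proof -
    have "successively E (drop i ys)" using W by (metis append_take_drop_id successively_append_iff)
    then have "?W (drop i ys)" using W i set_drop_subset[of i ys] by (auto simp: hd_drop_conv_nth)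
    then show ?thesis using min[of "drop i ys"] i by simp
  qed
  have noB: "Suc i = length ys" if i: "i < length ys" "B (ys!i)" for i
  proof -
    have "successively E (take (Suc i) ys)" using W by (metis append_take_drop_id successively_append_iff)
    moreover have "last (take (Suc i) ys) = ys!i" using i by (simp add: take_Suc_conv_app_nth)
    ultimately have "?W (take (Suc i) ys)" using W i set_take_subset[of "Suc i" ys] by auto
    then show ?thesis using min[of "take (Suc i) ys"] i by simp
  qed
  \<comment> \<open>A repetition becomes a chord from the first copy to the successor of the second
    one. If the second copy is the last vertex, \<open>B\<close> already holds at the first
    copy.\<close>
  have neq: "ys!i \<noteq> ys!j" if ij: "i < j" "j < length ys" for i j
  proof
    assume eq: "ys!i = ys!j"
    show False
    proof (cases "Suc j < length ys")
      case True
      then have "E (ys!i) (ys!Suc j)" using suc[of j] eq by simp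
      then show False using cut[of i "Suc j"] ij True by simp
    next
      case False
      then have "j = length ys - 1" using ij by simp
      then have "ys!j = last ys" using W by (simp add: last_conv_nth)
      then have "B (ys!i)" using W eq by simp
      then show False using noB[of i] ij False by simp
    qed
  qed
  have dist: "distinct ys" unfolding distinct_conv_nth by (metis neq nat_neq_iff)
  have "induced_path E ys"
    unfolding induced_path_def
  proof (intro conjI allI impI)
    show "ys \<noteq> []" "distinct ys" using W dist by auto
    fix i j assume ij: "i < length ys" "j < length ys"
    have "j = Suc i" if "i < j" "E (ys!i) (ys!j)" using cut[of i j] ij that by force
    moreover have "i = Suc j" if "j < i" "E (ys!i) (ys!j)" using cut[of j i] ij that sym by force
    ultimately show "E (ys!i) (ys!j) = (i = j + 1 \<or> j = i + 1)"
      using suc[of i] suc[of j] ij sym_iff[of "ys!i" "ys!j"] by (cases i j rule: linorder_cases) auto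
  qed
  moreover have "\<forall>y\<in>set ys. A y \<longleftrightarrow> y = hd ys"
    using noA W by (metis hd_conv_nth in_set_conv_nth)
  moreover have "\<forall>y\<in>set ys. B y \<longleftrightarrow> y = last ys"
    using noB W by (metis diff_Suc_1 in_set_conv_nth last_conv_nth)
  ultimately show ?thesis using that W by blast
qed

end

section \<open>Parity of the gaps between marked positions on a line\<close>

lemma gap_parity:
  fixes C :: "nat set" and W :: "nat \<Rightarrow> nat"
  assumes "0 \<in> C"
    and gap: "\<And>g h. g \<in> C \<Longrightarrow> h \<in> C \<Longrightarrow> g < h \<Longrightarrow> (\<And>i. g < i \<Longrightarrow> i < h \<Longrightarrow> i \<notin> C) \<Longrightarrow>
      even (h - g + sum W {g..<h})"
  shows "h \<in> C \<Longrightarrow> even (h + sum W {..<h})"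
proof (induction h rule: less_induct)
  case (less h)
  show ?case
  proof (cases "h = 0")
    case False
    let ?S = "{g\<in>C. g < h}"
    define g where "g = Max ?S"
    have S: "finite ?S" "?S \<noteq> {}" using \<open>0 \<in> C\<close> False by auto
    have g: "g \<in> C" "g < h" using Max_in[OF S] by (auto simp: g_def)
    have "i \<notin> C" if "g < i" "i < h" for i
    proof
      assume "i \<in> C"
      then have "i \<le> g" unfolding g_def using that by (intro Max_ge[OF S(1)]) simp
      then show False using that by simp
    qed
    then have "even (h - g + sum W {g..<h})" using gap g less.prems by blast
    moreover have "even (g + sum W {..<g})" using less.IH g by blast
    moreover have "sum W {..<h} = sum W {..<g} + sum W {g..<h}"
      using g sum.atLeastLessThan_concat[of 0 g h W] by (simp add: atLeast0LessThan)
    ultimately show ?thesis using g by auto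
  qed simp
qed

text \<open>Let \<open>w C\<close> mark the unit gaps of \<open>C\<close>. Every gap of
  \<open>A\<close> is a unit or even, so \<open>N\<close> plus the number of unit gaps of
  \<open>A\<close> is even; the same holds for \<open>B\<close>. In the union the unit gaps are
  those of \<open>A\<close> and those of \<open>B\<close>, because mixed gaps are even. As
  \<open>N\<close> is odd, both counts are odd, so their sum is even, while the union demands that
  it be odd.\<close>

lemma merge_parity:
  fixes A B :: "nat set"
  assumes N: "odd N" "N > 1" "0 \<in> A" "0 \<in> B" "N \<in> A" "N \<in> B"
    and disj: "\<And>i. 0 < i \<Longrightarrow> i < N \<Longrightarrow> i \<in> A \<Longrightarrow> i \<notin> B"
    and bnd: "\<And>i. i \<in> A \<union> B \<Longrightarrow> i \<le> N"
    and A: "\<And>g h. g \<in> A \<Longrightarrow> h \<in> A \<Longrightarrow> g < h \<Longrightarrow> (\<And>i. g < i \<Longrightarrow> i < h \<Longrightarrow> i \<notin> A) \<Longrightarrow> h = Suc g \<or> even (h - g)"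
    and B: "\<And>g h. g \<in> B \<Longrightarrow> h \<in> B \<Longrightarrow> g < h \<Longrightarrow> (\<And>i. g < i \<Longrightarrow> i < h \<Longrightarrow> i \<notin> B) \<Longrightarrow> h = Suc g \<or> even (h - g)"
    and AB: "\<And>g h. g \<in> A \<and> h \<in> B \<or> g \<in> B \<and> h \<in> A \<Longrightarrow> 0 < g \<Longrightarrow> g < h \<Longrightarrow> h < N \<Longrightarrow>
      (\<And>i. g < i \<Longrightarrow> i < h \<Longrightarrow> i \<notin> A \<union> B) \<Longrightarrow> even (h - g)"
  shows False
proof -
  define w where "w C i = (if i \<in> C \<and> Suc i \<in> C then 1 else 0 :: nat)" for C :: "nat set" and i
  have w0: "sum (w C) {g..<h} = 0" if "\<And>i. g < i \<Longrightarrow> i < h \<Longrightarrow> i \<notin> C" "Suc g < h" for C g h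
  proof (intro sum.neutral ballI)
    fix i assume "i \<in> {g..<h}"
    then show "w C i = 0" using that(1)[of i] that(1)[of "Suc g"] that(2)
      by (cases "i = g") (auto simp: w_def)
  qed
  have ww: "even (h - g + sum (w C) {g..<h})"
    if "h = Suc g \<or> even (h - g)" "g \<in> C" "h \<in> C" "g < h" "\<And>i. g < i \<Longrightarrow> i < h \<Longrightarrow> i \<notin> C" for C g h
  proof (cases "h = Suc g")
    case True
    then show ?thesis using that by (simp add: w_def)
  next
    case False
    then have "sum (w C) {g..<h} = 0" by (intro w0) (use that in auto)
    then show ?thesis using that False by simp
  qed
  have "even (N + sum (w A) {..<N})"
  proof (rule gap_parity[of A])
    fix g h assume "g \<in> A" "h \<in> A" "g < h" "\<And>i. g < i \<Longrightarrow> i < h \<Longrightarrow> i \<notin> A"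
    then show "even (h - g + sum (w A) {g..<h})" using A by (intro ww) blast+
  qed (use N in auto)
  moreover have "even (N + sum (w B) {..<N})"
  proof (rule gap_parity[of B])
    fix g h assume "g \<in> B" "h \<in> B" "g < h" "\<And>i. g < i \<Longrightarrow> i < h \<Longrightarrow> i \<notin> B"
    then show "even (h - g + sum (w B) {g..<h})" using B by (intro ww) blast+
  qed (use N in auto)
  moreover have "even (N + sum (\<lambda>i. w A i + w B i) {..<N})"
  proof (rule gap_parity[of "A \<union> B"])
    fix g h assume gh: "g \<in> A \<union> B" "h \<in> A \<union> B" "g < h" and no: "\<And>i. g < i \<Longrightarrow> i < h \<Longrightarrow> i \<notin> A \<union> B"
    have hN: "h \<le> N" using bnd gh by blast
    consider (a) "g \<in> A" "h \<in> A" | (b) "g \<in> B" "h \<in> B" | (ab) "\<not> (g \<in> A \<and> h \<in> A)" "\<not> (g \<in> B \<and> h \<in> B)"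
      by blast
    then show "even (h - g + (\<Sum>i = g..<h. w A i + w B i))"
    proof cases
      case ab
      then have m: "g \<in> A \<and> h \<in> B \<or> g \<in> B \<and> h \<in> A" using gh by blast
      \<comment> \<open>Both 0 and \<open>N\<close> lie in both sets, so the ends of a mixed gap are
        strictly inside.\<close>
      have "0 < g" "h < N" using ab gh N hN by (auto intro: Nat.gr0I simp: le_less)
      then have ev: "even (h - g)" using AB[OF m] gh no by blast
      then have "h \<noteq> Suc g" by auto
      then have "sum (w A) {g..<h} = 0" "sum (w B) {g..<h} = 0"
        by (intro w0; use gh no in auto)+
      then show ?thesis using ev by (simp add: sum.distrib)
    next
      case a
      have 1: "h = Suc g \<or> even (h - g)" using A[OF a gh(3)] no by blast
      have "even (h - g + sum (w A) {g..<h})" by (rule ww[OF 1]) (use a gh no in auto)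
      moreover have "sum (w B) {g..<h} = 0"
      proof (cases "h = Suc g")
        case True
        \<comment> \<open>The sets share only 0 and \<open>N\<close>, which are not consecutive, so
          a unit gap is never counted twice.\<close>
        have "\<not> (g \<in> B \<and> h \<in> B)"
        proof
          assume "g \<in> B \<and> h \<in> B"
          then have "g = 0" "h = N" using disj[of g] disj[of h] a gh hN by force+
          then show False using True N by simp
        qed
        then show ?thesis using True by (simp add: w_def)
      next
        case False
        then show ?thesis by (intro w0) (use gh no in auto)
      qed
      ultimately show ?thesis by (simp add: sum.distrib)
    next
      case b
      have 1: "h = Suc g \<or> even (h - g)" using B[OF b gh(3)] no by blast
      have "even (h - g + sum (w B) {g..<h})" by (rule ww[OF 1]) (use b gh no in auto)
      moreover have "sum (w A) {g..<h} = 0"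
      proof (cases "h = Suc g")
        case True
        have "\<not> (g \<in> A \<and> h \<in> A)"
        proof
          assume "g \<in> A \<and> h \<in> A"
          then have "g = 0" "h = N" using disj[of g] disj[of h] b gh hN by force+
          then show False using True N by simp
        qed
        then show ?thesis using True by (simp add: w_def)
      next
        case False
        then show ?thesis by (intro w0) (use gh no in auto)
      qed
      ultimately show ?thesis by (simp add: sum.distrib)
    qed
  qed (use N in auto)
  ultimately show False using N by (simp add: sum.distrib)
qed

section \<open>Even holes and the vertices adjacent to both ends of an edge of a hole\<close>

text \<open>A hole is given as an induced path \<open>p\<close> and one vertex \<open>x\<close> that
  sees exactly the two ends of \<open>p\<close>. It has \<open>length p + 1\<close> vertices, so an
  even hole means an odd \<open>length p\<close>, and cyclic indices are avoided; the bound 3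
  excludes triangles. The three paths of a prism run from one triangle to the other, and their
  length bound keeps the triangles disjoint.\<close>

locale prism_free_graph = ugraph +
  assumes hole: "\<lbrakk>induced_path E p; x \<notin> set p; 3 \<le> length p;
      \<And>y. y \<in> set p \<Longrightarrow> E x y \<longleftrightarrow> y = hd p \<or> y = last p\<rbrakk> \<Longrightarrow> odd (length p)"
    and C4: "\<lbrakk>E a b; E b c; E c d; E d a; a \<noteq> c; b \<noteq> d\<rbrakk> \<Longrightarrow> E a c \<or> E b d"
    and no_prism: "\<lbrakk>induced_path E p; induced_path E q; induced_path E r;
      set p \<inter> set q = {}; set p \<inter> set r = {}; set q \<inter> set r = {};
      2 \<le> length p; 2 \<le> length q; 2 \<le> length r;
      \<And>x y. x \<in> set p \<Longrightarrow> y \<in> set q \<Longrightarrow> E x y \<longleftrightarrow> x = hd p \<and> y = hd q \<or> x = last p \<and> y = last q;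
      \<And>x y. x \<in> set p \<Longrightarrow> y \<in> set r \<Longrightarrow> E x y \<longleftrightarrow> x = hd p \<and> y = hd r \<or> x = last p \<and> y = last r;
      \<And>x y. x \<in> set q \<Longrightarrow> y \<in> set r \<Longrightarrow> E x y \<longleftrightarrow> x = hd q \<and> y = hd r \<or> x = last q \<and> y = last r\<rbrakk>
      \<Longrightarrow> False"
begin

text \<open>The hole goes from \<open>w\<close> to \<open>u\<close>, along the path to
  \<open>g\<close>, across to \<open>hd X\<close> and along \<open>X\<close> back to
  \<open>w\<close>. Without \<open>w\<close> it has \<open>length A + length X + 2\<close>
  vertices.\<close>

lemma hub_side_parity:
  assumes P: "induced_path E (u # A @ [g])" and X: "induced_path E X"
    and w: "E w u" "w \<notin> set (u # A @ [g])" "\<forall>y\<in>set (A @ [g]). \<not> E w y"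
    and X1: "u \<notin> set X" "w \<notin> set X" "set (A @ [g]) \<inter> set X = {}"
    and Xu: "\<forall>x\<in>set X. \<not> E x u" and Xw: "\<forall>x\<in>set X. E w x \<longleftrightarrow> x = last X"
    and XP: "\<forall>x\<in>set X. \<forall>y\<in>set (A @ [g]). E y x \<longleftrightarrow> y = g \<and> x = hd X"
  shows "odd (length A + length X)"
proof -
  have Xne: "X \<noteq> []" using X by auto
  have gu: "g \<noteq> u" using P by (auto simp: induced_path_Cons_iff)
  have Xu': "\<forall>x\<in>set X. \<not> E u x" using Xu sym by blast
  have "induced_path E ((u # A @ [g]) @ X)"
  proof (rule induced_path_appendI[OF P X])
    show "set (u # A @ [g]) \<inter> set X = {}" using X1 by auto
    show "E y x \<longleftrightarrow> y = last (u # A @ [g]) \<and> x = hd X" if "y \<in> set (u # A @ [g])" "x \<in> set X" for y x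
    proof (cases "y = u")
      case True
      then show ?thesis using Xu' that(2) gu by simp
    next
      case False
      then have "y \<in> set (A @ [g])" using that(1) by simp
      then have "E y x \<longleftrightarrow> y = g \<and> x = hd X" using XP that(2) by blast
      then show ?thesis by simp
    qed
  qed
  moreover have "E w y \<longleftrightarrow> y = hd ((u # A @ [g]) @ X) \<or> y = last ((u # A @ [g]) @ X)"
    if "y \<in> set ((u # A @ [g]) @ X)" for y
  proof (cases "y \<in> set X")
    case True
    then have "y \<noteq> u" "E w y \<longleftrightarrow> y = last X" using X1 Xw by auto
    then show ?thesis using Xne by simp
  next
    case False
    then have "y \<noteq> last X" using Xne last_in_set by blast
    moreover have "y = u \<or> y \<in> set (A @ [g]) \<and> y \<noteq> u" using that False P by (auto simp: induced_path_Cons_iff)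
    ultimately show ?thesis using w Xne by auto
  qed
  ultimately have "odd (length ((u # A @ [g]) @ X))"
    using w X1 Xne by (intro hole[of _ w]) (auto simp: Suc_le_eq)
  then show ?thesis by simp
qed

text \<open>If \<open>w\<close> missed \<open>P\<close>, the holes through \<open>X\<close> and the first and last neighbours of \<open>hd X\<close> on \<open>P\<close>
would force these two neighbours to be adjacent, which gives a prism.\<close>

lemma hub_meets_hole:
  assumes P: "induced_path E P" "2 \<le> length P"
    and u: "u \<notin> set P" "\<forall>y\<in>set P. E u y \<longleftrightarrow> y = hd P"
    and v: "v \<notin> set P" "\<forall>y\<in>set P. E v y \<longleftrightarrow> y = last P"
    and uvw: "E u v" "E w u" "E w v" and w: "w \<notin> set P"
    and X: "induced_path E X" "set P \<inter> set X = {}" "w \<notin> set X"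
    and Xuv: "\<forall>x\<in>set X. x \<noteq> u \<and> x \<noteq> v \<and> \<not> E x u \<and> \<not> E x v"
    and Xw: "\<forall>x\<in>set X. E w x \<longleftrightarrow> x = last X"
    and XP: "\<forall>x\<in>set X. (\<exists>y\<in>set P. E x y) \<longleftrightarrow> x = hd X"
  shows "\<exists>y\<in>set P. E w y"
proof (rule ccontr)
  assume miss: "\<not> (\<exists>y\<in>set P. E w y)"
  let ?x = "hd X"
  have ne: "X \<noteq> []" "P \<noteq> []" using X P by auto
  have xX: "?x \<in> set X" using ne by simp
  have Xuv': "\<forall>x\<in>set X. \<not> E u x \<and> \<not> E v x" using Xuv sym by blast
  have miss': "\<forall>y\<in>set P. \<not> E y w" using miss sym by blast
  have uv: "u \<noteq> v" "u \<noteq> w" "v \<noteq> w" using uvw by auto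
  have wuv: "E u w" "E v w" "E v u" using uvw sym by blast+
  have uP: "induced_path E (u # P)" using ne P u by (simp add: induced_path_Cons_iff)
  have vP: "induced_path E (v # rev P)"
    using ne P v by (simp add: induced_path_Cons_iff hd_rev)
  have Pv: "induced_path E (P @ [v])" using vP by (metis induced_path_rev rev.simps(2) rev_rev_ident)
  have "odd (length (P @ [v]))"
  proof (rule hole[OF Pv])
    show "u \<notin> set (P @ [v])" "3 \<le> length (P @ [v])" using u uv P by auto
    show "E u y \<longleftrightarrow> y = hd (P @ [v]) \<or> y = last (P @ [v])" if "y \<in> set (P @ [v])" for y
      using that u uvw ne v by auto
  qed
  then have evP: "even (length P)" by simp
  have ex: "\<exists>y\<in>set P. E ?x y" using XP xX by blast
  obtain A g B where P1: "P = A @ g # B" "E ?x g" "\<forall>y\<in>set A. \<not> E ?x y"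
    using split_list_first_prop[OF ex] by blast
  obtain A' h C where P2: "P = A' @ h # C" "E ?x h" "\<forall>y\<in>set C. \<not> E ?x y"
    using split_list_last_prop[OF ex] by blast
  have dist: "distinct P" using P by (simp add: induced_path_def)
  have adj: "E y x \<longleftrightarrow> x = ?x \<and> E ?x y" if "y \<in> set P" "x \<in> set X" for x y
    using that XP sym by metis
  have uA: "induced_path E (u # A @ [g])"
    using induced_path_appendD(1)[of "u # A @ [g]" B] uP P1 by simp
  have vC: "induced_path E (v # rev C @ [h])"
    using induced_path_appendD(1)[of "v # rev C @ [h]" "rev A'"] vP P2 by simp
  have l: "odd (length A + length X)"
    by (rule hub_side_parity[OF uA X(1), of w])
      (use P1 miss uvw uv w X Xuv Xw u adj in \<open>auto simp: P1(1)\<close>)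
  have r: "odd (length (rev C) + length X)"
    by (rule hub_side_parity[OF vC X(1), of w])
      (use P2 miss uvw uv w X Xuv Xw v adj in \<open>auto simp: P2(1)\<close>)
  \<comment> \<open>\<open>A\<close> lies before the first and \<open>C\<close> after the last
    neighbour of \<open>?x\<close> on \<open>P\<close>; both lengths have the parity opposite to
    that of \<open>X\<close>. Since \<open>P\<close> has even length, a single neighbour is
    impossible.\<close>
  have ev: "even (length A + length C)" using l r by auto
  show False
  proof (cases "\<exists>y\<in>set B. E ?x y")
    case False
    then have "h \<notin> set B" using P2 by blast
    moreover have "h \<in> set P" using P2 by simp
    then have "h = g" using P1 P2 \<open>h \<notin> set B\<close> by auto
    then have "A' = A \<and> C = B" using P1(1) P2(1) dist by (metis append_Cons_eq_iff distinct_append disjoint_iff list.set_intros(1) distinct.simps(2))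
    then have "length P = length A + length C + 1" using P1 by simp
    then show False using evP ev by simp
  next
    case True
    then obtain M h' C' where B: "B = M @ h' # C'" "E ?x h'" "\<forall>y\<in>set C'. \<not> E ?x y"
      using split_list_last_prop[OF True] by blast
    have PB: "P = (A @ g # M) @ h' # C'" using P1 B by simp
    have "h' \<notin> set C" "h \<notin> set C'" using P2 B by auto
    then have hC: "h' = h" "C' = C"
    proof -
      have "A' @ h # C = (A @ g # M) @ h' # C'" using PB P2 by simp
      then have "A' = A @ g # M \<and> h = h' \<and> C = C'"
        using P2 B by (auto simp: append_eq_append_conv2 Cons_eq_append_conv append_eq_Cons_conv)
      then show "h' = h" "C' = C" by auto
    qed
    have PM: "P = A @ g # M @ h # C" using PB hC by simp
    show False
    proof (cases "M = []")
      \<comment> \<open>Then \<open>?x\<close> bypasses \<open>M\<close>, and the hole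
        \<open>u\<close>, \<open>A\<close>, \<open>g\<close>, \<open>?x\<close>, \<open>h\<close>,
        \<open>C\<close>, \<open>v\<close> has an odd number of vertices. Neighbours of
        \<open>?x\<close> inside \<open>M\<close> do no harm, because the hole avoids
        \<open>M\<close>.\<close>
      case False
      have Ag: "induced_path E (A @ [g])"
        using induced_path_appendD(1)[of "A @ [g]" "M @ h # C"] P PM by simp
      have hCi: "induced_path E (h # C)"
        using induced_path_appendD(2)[of "A @ g # M" "h # C"] P PM by simp
      have hCv: "induced_path E ((h # C) @ [v])"
        using induced_path_appendD(2)[of "A @ g # M" "h # C @ [v]"] Pv PM by simp
      have nadj: "\<not> E y z" if "y \<in> set (A @ [g])" "z \<in> set (h # C)" for y z
        using induced_path_appendD(4)[of "A @ [g]" "M @ h # C" y z] P PM that False dist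
        by (auto simp: hd_append) (metis IntI empty_iff hd_in_set)+
      have 1: "induced_path E ((A @ [g]) @ [?x])"
        by (rule induced_path_appendI[OF Ag])
          (use P1 adj PM xX X in auto)
      have 2: "induced_path E (((A @ [g]) @ [?x]) @ ((h # C) @ [v]))"
      proof (rule induced_path_appendI[OF 1 hCv])
        show "set ((A @ [g]) @ [?x]) \<inter> set ((h # C) @ [v]) = {}"
          using dist PM X xX Xuv v by auto
        show "E y z \<longleftrightarrow> y = last ((A @ [g]) @ [?x]) \<and> z = hd ((h # C) @ [v])"
          if y: "y \<in> set ((A @ [g]) @ [?x])" and z: "z \<in> set ((h # C) @ [v])" for y z
        proof -
          have "\<not> E y v" if "y \<in> set (A @ [g])"
          proof -
            have "y \<in> set P" "y \<noteq> last P" using that dist PM by auto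
            then show ?thesis using v sym_iff by blast
          qed
          moreover have "\<not> E ?x v" using Xuv xX by blast
          moreover have "?x \<notin> set P" using X xX by blast
          moreover have "v \<noteq> h" using v PM by auto
          ultimately show ?thesis using y z nadj[of y z] P2 PM by auto
        qed
      qed
      have "odd (length (((A @ [g]) @ [?x]) @ ((h # C) @ [v])))"
      proof (rule hole[OF 2])
        show "u \<notin> set (((A @ [g]) @ [?x]) @ ((h # C) @ [v]))"
          using u PM Xuv xX uv by auto
        show "E u y \<longleftrightarrow> y = hd (((A @ [g]) @ [?x]) @ ((h # C) @ [v])) \<or> y = last (((A @ [g]) @ [?x]) @ ((h # C) @ [v]))"
          if "y \<in> set (((A @ [g]) @ [?x]) @ ((h # C) @ [v]))" for y
        proof -
          have "hd (((A @ [g]) @ [?x]) @ ((h # C) @ [v])) = hd P" using PM by (cases A) auto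
          moreover have "\<not> E u ?x" using Xuv xX sym by blast
          moreover have "?x \<noteq> hd P" using X xX hd_in_set[OF ne(2)] by auto
          moreover have "?x \<noteq> v" using Xuv xX by blast
          moreover have "v \<noteq> hd P" using v ne hd_in_set by blast
          ultimately show ?thesis using that u uvw PM v by auto
        qed
      qed simp
      then show False using ev by simp
    next
      case True
      have gh: "E g h" using induced_path_successively[OF P(1)] PM True by (simp add: successively_append_iff successively_Cons)
      \<comment> \<open>The triangles are \<open>u v w\<close> and \<open>g h ?x\<close>;
        \<open>A\<close>, the reverse of \<open>C\<close>, and the reverse of \<open>X\<close>
        provide the three paths between them.\<close>
      show False
      proof (rule no_prism[OF uA vC, of "w # rev X"])
        have hX: "hd (rev X) = last X" "last (rev X) = ?x" by (simp_all add: hd_rev last_rev)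
        show wX: "induced_path E (w # rev X)"
          using X Xw ne by (simp add: induced_path_Cons_iff hd_rev)
        show "set (u # A @ [g]) \<inter> set (v # rev C @ [h]) = {}" using dist PM u v uv by auto
        show "set (u # A @ [g]) \<inter> set (w # rev X) = {}" "set (v # rev C @ [h]) \<inter> set (w # rev X) = {}"
          using X w u v uv Xuv PM by auto
        show "2 \<le> length (w # rev X)" using ne by (cases X) auto
        have gu: "g \<noteq> u" "h \<noteq> v" using u v PM by auto
        have lg: "last (w # rev X) = ?x" using ne by (simp add: last_rev)
        have e1: "E y z \<longleftrightarrow> y = g \<and> z = h" if "y \<in> set (A @ [g])" "z \<in> set (h # C)" for y z
          using induced_path_appendD(4)[of "A @ [g]" "h # C" y z] P PM that True by simp
        have e2: "\<not> E u z" if "z \<in> set (h # C)" for z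
        proof -
          have "hd P \<in> set (A @ [g])" using PM by (cases A) auto
          then have "z \<noteq> hd P" using that dist PM by auto
          then show ?thesis using u that PM by auto
        qed
        have e3: "\<not> E y v" if "y \<in> set (A @ [g])" for y
        proof -
          have "last P \<in> set (h # C)" using PM by auto
          then have "y \<noteq> last P" using that dist PM by auto
          then show ?thesis using v that PM sym[of y v] by auto
        qed
        show "E y z \<longleftrightarrow> y = hd (u # A @ [g]) \<and> z = hd (v # rev C @ [h]) \<or>
            y = last (u # A @ [g]) \<and> z = last (v # rev C @ [h])"
          if "y \<in> set (u # A @ [g])" "z \<in> set (v # rev C @ [h])" for y z
          using that e1[of y z] e2[of z] e3[of y] uvw gu u v PM by auto
        show "E y z \<longleftrightarrow> y = hd (u # A @ [g]) \<and> z = hd (w # rev X) \<or>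
            y = last (u # A @ [g]) \<and> z = last (w # rev X)"
          if "y \<in> set (u # A @ [g])" "z \<in> set (w # rev X)" for y z
          unfolding lg
          using that adj[of y z] miss wuv Xuv Xuv' miss' gu u w P1 PM xX X(3)
          by auto
        show "E y z \<longleftrightarrow> y = hd (v # rev C @ [h]) \<and> z = hd (w # rev X) \<or>
            y = last (v # rev C @ [h]) \<and> z = last (w # rev X)"
          if "y \<in> set (v # rev C @ [h])" "z \<in> set (w # rev X)" for y z
          unfolding lg
          using that adj[of y z] miss wuv Xuv Xuv' miss' gu v w P2 PM xX X(3)
          by auto
      qed (auto)
    qed
  qed
qed

lemma induced_path_slice:
  assumes "induced_path E q" "g \<le> h" "h < length q"
  shows "induced_path E (map ((!) q) [g..<Suc h])"
proof -
  have "inj_on ((!) q) {g..<Suc h}"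
    using assms by (auto simp: induced_path_def inj_on_def nth_eq_iff_index_eq)
  then show ?thesis
    using assms by (auto simp: induced_path_def distinct_map simp del: upt_Suc)
qed

lemma hd_last_slice:
  "g \<le> h \<Longrightarrow> hd (map f [g..<Suc h]) = f g" "g \<le> h \<Longrightarrow> last (map f [g..<Suc h]) = f h"
  by (simp_all add: hd_map last_map upt_rec[of g])

text \<open>Unless the two neighbours are consecutive on \<open>q\<close>, \<open>x\<close> closes
  the stretch between them, which has \<open>h - g + 1\<close> vertices, to a hole.\<close>

lemma sector_parity:
  assumes q: "induced_path E q" and gh: "g < h" "h < length q" and x: "x \<notin> set q"
    and ends: "E x (q!g)" "E x (q!h)" and inner: "\<And>i. g < i \<Longrightarrow> i < h \<Longrightarrow> \<not> E x (q!i)"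
  shows "h = Suc g \<or> even (h - g)"
proof (rule ccontr)
  assume no: "\<not> ?thesis"
  let ?s = "map ((!) q) [g..<Suc h]"
  have dist: "distinct q" using q by (simp add: induced_path_def)
  have "odd (length ?s)"
  proof (rule hole[of ?s x])
    show "induced_path E ?s" using induced_path_slice[OF q] gh by simp
    show "x \<notin> set ?s" using x gh by (auto simp del: upt_Suc)
    have "h \<noteq> Suc g" using no by blast
    then show "3 \<le> length ?s" using gh by (simp; linarith)
    fix y assume "y \<in> set ?s"
    then obtain i where i: "g \<le> i" "i \<le> h" "y = q!i" by (auto simp del: upt_Suc)
    have "y = hd ?s \<longleftrightarrow> i = g" "y = last ?s \<longleftrightarrow> i = h"
      using i gh dist hd_last_slice[of g h "(!) q"] by (simp_all add: nth_eq_iff_index_eq del: upt_Suc)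
    then show "E x y \<longleftrightarrow> y = hd ?s \<or> y = last ?s"
      using ends inner[of i] i by (metis le_neq_implies_less)
  qed
  then show False using no gh by simp
qed

text \<open>The stretch extended by \<open>x\<close> and \<open>x'\<close> is an induced path on
  \<open>h - g + 3\<close> vertices, and \<open>t\<close>, which sees both hubs but not the stretch,
  closes it to a hole.\<close>

lemma alternation_parity:
  assumes p: "induced_path E p" and gh: "g \<le> h" "h < length p"
    and x: "\<And>i. g \<le> i \<Longrightarrow> i \<le> h \<Longrightarrow> E x (p!i) \<longleftrightarrow> i = g"
    and x': "\<And>i. g \<le> i \<Longrightarrow> i \<le> h \<Longrightarrow> E x' (p!i) \<longleftrightarrow> i = h"
    and xx: "x \<noteq> x'" "\<not> E x x'" "x \<notin> set p" "x' \<notin> set p"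
    and t: "E t x" "E t x'" "t \<notin> set p" "\<And>i. g \<le> i \<Longrightarrow> i \<le> h \<Longrightarrow> \<not> E t (p!i)"
  shows "even (h - g)"
proof -
  let ?s = "map ((!) p) [g..<Suc h]"
  have dist: "distinct p" using p by (simp add: induced_path_def)
  have s: "induced_path E ?s" using induced_path_slice[OF p] gh by simp
  have ne: "?s \<noteq> []" using gh by simp
  have el: "\<exists>i. g \<le> i \<and> i \<le> h \<and> y = p!i \<and> (y = hd ?s \<longleftrightarrow> i = g) \<and> (y = last ?s \<longleftrightarrow> i = h)"
    if "y \<in> set ?s" for y
  proof -
    obtain i where i: "g \<le> i" "i \<le> h" "y = p!i" using \<open>y \<in> set ?s\<close> by (auto simp del: upt_Suc)
    have "y = hd ?s \<longleftrightarrow> i = g" "y = last ?s \<longleftrightarrow> i = h"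
      using i gh dist hd_last_slice[of g h "(!) p"] by (simp_all add: nth_eq_iff_index_eq del: upt_Suc)
    then show ?thesis using i by blast
  qed
  have sub: "set ?s \<subseteq> set p" using gh by (auto simp del: upt_Suc)
  have 1: "\<forall>y\<in>set ?s. E x y \<longleftrightarrow> y = hd ?s" using el x by metis
  have 2: "\<forall>y\<in>set ?s. E x' y \<longleftrightarrow> y = last ?s" using el x' by metis
  have 3: "\<forall>y\<in>set ?s. \<not> E t y" using el t by metis
  have s1: "induced_path E (x # ?s)" using ne s 1 sub xx by (subst induced_path_Cons_iff) auto
  have 4: "E y z \<longleftrightarrow> y = last (x # ?s) \<and> z = hd [x']" if "y \<in> set (x # ?s)" "z \<in> set [x']" for y z
  proof (cases "y = x")
    case True
    then have "y \<noteq> last ?s" using ne sub xx last_in_set by blast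
    then show ?thesis using True that xx ne by simp
  next
    case False
    then have "y \<in> set ?s" using that by auto
    then have "E x' y \<longleftrightarrow> y = last ?s" using 2 by blast
    moreover have "z = x'" using that by simp
    moreover have "last (x # ?s) = last ?s" using ne by simp
    ultimately show ?thesis using sym_iff[of y x'] by (metis list.sel(1))
  qed
  have "set (x # ?s) \<inter> set [x'] = {}" using sub xx by (auto simp del: upt_Suc)
  then have s2: "induced_path E ((x # ?s) @ [x'])"
    by (intro induced_path_appendI s1 induced_path_single 4)
  have "odd (length ((x # ?s) @ [x']))"
  proof (rule hole[OF s2, of t])
    show "t \<notin> set ((x # ?s) @ [x'])" using t sub by (auto simp del: upt_Suc)
    show "3 \<le> length ((x # ?s) @ [x'])" using gh by simp
    show "E t y \<longleftrightarrow> y = hd ((x # ?s) @ [x']) \<or> y = last ((x # ?s) @ [x'])"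
      if "y \<in> set ((x # ?s) @ [x'])" for y
    proof -
      have "y = x \<or> y = x' \<or> y \<in> set ?s \<and> y \<noteq> x \<and> y \<noteq> x'"
        using that sub xx by (auto simp del: upt_Suc)
      then show ?thesis using t 3 by auto
    qed
  qed
  then show ?thesis using gh by simp
qed

text \<open>Cut the hole at the edge \<open>uv\<close>. The neighbours of either hub split the resulting path of odd
length into sectors that are even or single edges, so each hub has an odd number of edge sectors. After
merging both neighbourhoods, a sector between different hubs is closed to a hole by \<open>u\<close> or by \<open>v\<close>,
hence even, unless it is all of \<open>P\<close>. In the absence of such a sector, the parity of the length is that
of the total number of edge sectors, which is even.\<close>

lemma two_hubs:
  assumes P: "induced_path E P" "2 \<le> length P"
    and u: "u \<notin> set P" "\<forall>y\<in>set P. E u y \<longleftrightarrow> y = hd P"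
    and v: "v \<notin> set P" "\<forall>y\<in>set P. E v y \<longleftrightarrow> y = last P"
    and uv: "E u v"
    and x: "E x u" "E x v" "x \<notin> set P" "\<exists>y\<in>set P. E x y"
    and x': "E x' u" "E x' v" "x' \<notin> set P" "\<exists>y\<in>set P. E x' y"
    and xx: "x \<noteq> x'" "\<not> E x x'"
  shows "(\<forall>y\<in>set P. (E x y \<longleftrightarrow> y = hd P) \<and> (E x' y \<longleftrightarrow> y = last P)) \<or>
    (\<forall>y\<in>set P. (E x y \<longleftrightarrow> y = last P) \<and> (E x' y \<longleftrightarrow> y = hd P))"
proof (rule ccontr)
  assume contr: "\<not> ?thesis"
  define n where "n = length P"
  have n: "2 \<le> n" using P by (simp add: n_def)
  \<comment> \<open>Positions 1 to \<open>n\<close> are \<open>P\<close>, and the positions 0 and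
    \<open>n + 1\<close> are neighbours of both hubs. The last position \<open>n + 1\<close> is odd
    because the hole is even.\<close>
  let ?L = "u # P @ [v]"
  define nb where "nb z = {i. i < n + 2 \<and> E z (?L!i)}" for z
  have dist: "distinct P" using P by (simp add: induced_path_def)
  have ne: "P \<noteq> []" using P by auto
  have uv': "u \<noteq> v" using uv by auto
  have uP: "induced_path E (u # P)" using ne P u by (simp add: induced_path_Cons_iff)
  have "induced_path E (v # rev P)"
    using ne P v by (simp add: induced_path_Cons_iff hd_rev)
  then have Pv: "induced_path E (P @ [v])" by (metis induced_path_rev rev.simps(2) rev_rev_ident)
  have "odd (length (P @ [v]))"
  proof (rule hole[OF Pv])
    show "u \<notin> set (P @ [v])" "3 \<le> length (P @ [v])" using u uv' P by auto
    show "E u y \<longleftrightarrow> y = hd (P @ [v]) \<or> y = last (P @ [v])" if "y \<in> set (P @ [v])" for y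
      using that u uv ne v by auto
  qed
  then have evn: "even n" by (simp add: n_def)
  have L: "?L!0 = u" "?L!Suc n = v" "\<And>i. 1 \<le> i \<Longrightarrow> i \<le> n \<Longrightarrow> ?L!i = P!(i-1)"
    "\<And>i. i \<le> n \<Longrightarrow> ?L!i = (u # P)!i" "\<And>i. ?L!Suc i = (P @ [v])!i"
    by (auto simp: n_def nth_Cons nth_append split: nat.splits)
  have uadj: "E u (P!i) \<longleftrightarrow> i = 0" if "i < n" for i
    using that u ne dist by (auto simp: n_def hd_conv_nth nth_eq_iff_index_eq)
  have vadj: "E v (P!i) \<longleftrightarrow> i = n - 1" if "i < n" for i
    using that v ne dist by (auto simp: n_def last_conv_nth nth_eq_iff_index_eq)
  have inP: "i - 1 < n \<and> i - 1 < length P" if "0 < i" "i < Suc n" for i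
    using that by (auto simp: n_def)
  have nbP: "i \<in> nb z \<longleftrightarrow> E z (P!(i-1))" if "0 < i" "i < Suc n" for i z
    using that L(3)[of i] by (auto simp: nb_def)
  have sect: "h = Suc g \<or> even (h - g)"
    if z: "E z u" "E z v" "z \<notin> set P" "\<exists>y\<in>set P. E z y" and gh: "g \<in> nb z" "h \<in> nb z" "g < h"
      and no: "\<And>i. g < i \<Longrightarrow> i < h \<Longrightarrow> i \<notin> nb z" for z g h
  proof -
    have zuv: "z \<noteq> u" "z \<noteq> v" using z by auto
    obtain k where k: "k < n" "E z (P!k)" using z by (auto simp: n_def in_set_conv_nth)
    then have "Suc k \<in> nb z" using nbP[of "Suc k"] by simp
    \<comment> \<open>\<open>?L\<close> is not an induced path, as its ends are adjacent. A sector
      is a proper part of it because the hub has a neighbour on \<open>P\<close>, so it lies on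
      \<open>u # P\<close> or on \<open>P @ [v]\<close>.\<close>
    then have "\<not> (g = 0 \<and> h = Suc n)" using no[of "Suc k"] k by auto
    then consider "h \<le> n" | "0 < g" using gh by (auto simp: nb_def)
    then show ?thesis
    proof cases
      case 1
      show ?thesis
      proof (rule sector_parity[OF uP gh(3), of z])
        show "h < length (u # P)" "z \<notin> set (u # P)" using 1 z zuv by (auto simp: n_def)
        show "E z ((u # P)!g)" "E z ((u # P)!h)" using gh 1 L(4)[of g] L(4)[of h] by (auto simp: nb_def)
        show "\<not> E z ((u # P)!i)" if "g < i" "i < h" for i
          using no[OF that] that 1 L(4)[of i] by (auto simp: nb_def)
      qed
    next
      case 2
      have hn: "h \<le> Suc n" using gh by (auto simp: nb_def)
      have "h - 1 = Suc (g - 1) \<or> even (h - 1 - (g - 1))"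
      proof (rule sector_parity[OF Pv, of _ _ z])
        show "g - 1 < h - 1" "h - 1 < length (P @ [v])" "z \<notin> set (P @ [v])"
          using 2 z zuv hn gh by (auto simp: n_def)
        show "E z ((P @ [v])!(g - 1))" "E z ((P @ [v])!(h - 1))"
          using gh 2 L(5)[of "g - 1"] L(5)[of "h - 1"] by (auto simp: nb_def)
        show "\<not> E z ((P @ [v])!i)" if "g - 1 < i" "i < h - 1" for i
          using no[of "Suc i"] that hn L(5)[of i] by (auto simp: nb_def)
      qed
      then show ?thesis using 2 gh by auto
    qed
  qed
  have alt: "even (h - g)"
    if z: "E z u" "E z v" "z \<notin> set P" "E z' u" "E z' v" "z' \<notin> set P" "z \<noteq> z'" "\<not> E z z'"
      and gh: "g \<in> nb z" "h \<in> nb z'" "0 < g" "g < h" "h < Suc n"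
      and no: "\<And>i. g < i \<Longrightarrow> i < h \<Longrightarrow> i \<notin> nb z \<union> nb z'"
      and gh': "g \<notin> nb z'" "h \<notin> nb z" and full: "\<not> (g = 1 \<and> h = n)" for z z' g h
  proof -
    \<comment> \<open>The closing vertex has to miss the sector. On \<open>P\<close>,
      \<open>u\<close> sees position 1 only and \<open>v\<close> sees position \<open>n\<close>
      only; if the sector starts at 1, it ends before \<open>n\<close> by
      \<open>full\<close>.\<close>
    let ?t = "if g = 1 then v else u"
    have "even (h - 1 - (g - 1))"
    proof (rule alternation_parity[OF P(1), of _ _ z z' ?t])
      show "g - 1 \<le> h - 1" "h - 1 < length P" using gh by (auto simp: n_def)
      fix i assume i: "g - 1 \<le> i" "i \<le> h - 1"
      have "i < n" using i gh by simp
      show "E z (P!i) \<longleftrightarrow> i = g - 1" "E z' (P!i) \<longleftrightarrow> i = h - 1"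
      proof -
        have eq: "E z (P!i) \<longleftrightarrow> Suc i \<in> nb z" "E z' (P!i) \<longleftrightarrow> Suc i \<in> nb z'"
          using nbP[of "Suc i"] \<open>i < n\<close> by simp_all
        consider "Suc i = g" | "Suc i = h" | "g < Suc i" "Suc i < h" using i gh by linarith
        then have "(Suc i \<in> nb z \<longleftrightarrow> Suc i = g) \<and> (Suc i \<in> nb z' \<longleftrightarrow> Suc i = h)"
          using gh gh' no[of "Suc i"] by cases auto
        then show "E z (P!i) \<longleftrightarrow> i = g - 1" "E z' (P!i) \<longleftrightarrow> i = h - 1"
          using eq gh by auto
      qed
      show "\<not> E ?t (P!i)" using uadj[OF \<open>i < n\<close>] vadj[OF \<open>i < n\<close>] full gh i by auto
    qed (use z u v sym in auto)
    then show ?thesis using gh by auto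
  qed
  \<comment> \<open>One of \<open>u\<close> and \<open>v\<close> does not see a given vertex of
    \<open>P\<close>; with the two hubs and a common neighbour of theirs on \<open>P\<close> it
    would form a C4.\<close>
  have disj: "i \<notin> nb x'" if i: "0 < i" "i < Suc n" "i \<in> nb x" for i
  proof
    assume "i \<in> nb x'"
    then have e: "E x (P!(i-1))" "E x' (P!(i-1))" using nbP i by auto
    obtain t where t: "E x t" "E x' t" "t \<noteq> P!(i-1)" "\<not> E t (P!(i-1))"
    proof (cases "i = 1")
      case True
      then have "\<not> E v (P!(i-1))" using vadj[of 0] n by simp
      moreover have "P!0 \<in> set P" using ne by simp
      ultimately show ?thesis using that[of v] x x' v True by auto
    next
      case False
      then have "\<not> E u (P!(i-1))" using uadj[of "i-1"] i by simp
      moreover have "P!(i-1) \<in> set P" using i by (simp add: n_def)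
      ultimately show ?thesis using that[of u] x x' u by auto
    qed
    have "E x x' \<or> E (P!(i-1)) t"
      by (rule C4[OF e(1) sym[OF e(2)] t(2) sym[OF t(1)] xx(1)]) (use t in auto)
    then show False using xx t sym by blast
  qed
  \<comment> \<open>A mixed sector that fills all of \<open>P\<close> is precisely the configuration
    allowed by the conclusion.\<close>
  have excl: False
    if z: "z = x \<and> z' = x' \<or> z = x' \<and> z' = x"
      and gh: "1 \<in> nb z" "n \<in> nb z'" and no: "\<And>i. 1 < i \<Longrightarrow> i < n \<Longrightarrow> i \<notin> nb z \<union> nb z'" for z z'
  proof -
    have "n \<notin> nb z" "1 \<notin> nb z'" using disj[of n] disj[of 1] gh z n by auto
    then have "E z (P!i) \<longleftrightarrow> i = 0" "E z' (P!i) \<longleftrightarrow> i = n - 1" if "i < n" for i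
      using nbP[of "Suc i"] no[of "Suc i"] gh that n by (cases "i = 0"; cases "i = n - 1"; auto)+
    then have "\<forall>y\<in>set P. (E z y \<longleftrightarrow> y = hd P) \<and> (E z' y \<longleftrightarrow> y = last P)"
      using uadj vadj u v by (metis in_set_conv_nth n_def)
    then show False using contr z by auto
  qed
  show False
  proof (rule merge_parity[of "Suc n" "nb x" "nb x'"])
    show "odd (Suc n)" "Suc n > 1" using evn n by auto
    show "0 \<in> nb x" "0 \<in> nb x'" "Suc n \<in> nb x" "Suc n \<in> nb x'"
      using x x' L by (auto simp: nb_def)
    show "\<And>i. i \<in> nb x \<union> nb x' \<Longrightarrow> i \<le> Suc n" by (auto simp: nb_def)
    show "even (h - g)" if gh: "g \<in> nb x \<and> h \<in> nb x' \<or> g \<in> nb x' \<and> h \<in> nb x" "0 < g" "g < h" "h < Suc n"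
      and no: "\<And>i. g < i \<Longrightarrow> i < h \<Longrightarrow> i \<notin> nb x \<union> nb x'" for g h
    proof -
      from gh(1) consider (1) "g \<in> nb x" "h \<in> nb x'" | (2) "g \<in> nb x'" "h \<in> nb x" by blast
      then show ?thesis
      proof cases
        case 1
        show ?thesis
        proof (rule alt[of x x'])
          show "\<not> (g = 1 \<and> h = n)" using excl[of x x'] 1 no by blast
        qed (use x x' xx 1 gh no disj in auto)
      next
        case 2
        show ?thesis
        proof (rule alt[of x' x])
          show "\<not> (g = 1 \<and> h = n)" using excl[of x' x] 2 no by blast
          show "\<And>i. g < i \<Longrightarrow> i < h \<Longrightarrow> i \<notin> nb x' \<union> nb x" using no by blast
          show "\<not> E x' x" using xx sym by blast
        qed (use x x' xx 2 gh no disj in auto)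
      qed
    qed
  qed (use sect[of x] sect[of x'] x x' disj in blast)+
qed

end

section \<open>Connected sets and shortest paths inside them\<close>

context ugraph
begin

lemma induced_path_snocI:
  assumes "induced_path E p" "v \<notin> set p" "\<And>y. y \<in> set p \<Longrightarrow> E v y \<longleftrightarrow> y = last p"
  shows "induced_path E (p @ [v])"
  using assms sym_iff[of _ v] by (intro induced_path_appendI) auto

lemma induced_path_ConsI:
  assumes "induced_path E p" "v \<notin> set p" "\<And>y. y \<in> set p \<Longrightarrow> E v y \<longleftrightarrow> y = hd p"
  shows "induced_path E (v # p)"
proof -
  have "p \<noteq> []" using assms by auto
  then show ?thesis using assms by (simp add: induced_path_Cons_iff)
qed

text \<open>Connectivity is witnessed by vertex lists inside \<open>F\<close>, which
  \<open>walk_imp_induced_path\<close> can shorten directly.\<close>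

definition connected_in :: "'a set \<Rightarrow> bool" where
  "connected_in F \<longleftrightarrow> (\<forall>x\<in>F. \<forall>y\<in>F. \<exists>xs. successively E xs \<and> xs \<noteq> [] \<and> hd xs = x \<and> last xs = y \<and> set xs \<subseteq> F)"

lemma connected_in_path:
  assumes "connected_in F" "x \<in> F" "A x" "y \<in> F" "B y"
  obtains ys where "induced_path E ys" "set ys \<subseteq> F"
    "\<forall>y\<in>set ys. A y \<longleftrightarrow> y = hd ys" "\<forall>y\<in>set ys. B y \<longleftrightarrow> y = last ys"
proof -
  obtain xs where xs: "successively E xs" "xs \<noteq> []" "hd xs = x" "last xs = y" "set xs \<subseteq> F"
    using assms unfolding connected_in_def by blast
  show ?thesis
  proof (rule walk_imp_induced_path[of xs A B])
    fix ys assume "induced_path E ys" "set ys \<subseteq> set xs"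
      "\<forall>y\<in>set ys. A y \<longleftrightarrow> y = hd ys" "\<forall>y\<in>set ys. B y \<longleftrightarrow> y = last ys"
    then show ?thesis using that[of ys] xs by blast
  qed (use xs assms in auto)
qed

text \<open>This is the component of \<open>c\<close> in the subgraph induced by \<open>N\<close>;
  with \<open>N\<close> the vertices outside the closed neighbourhoods of \<open>b1\<close> and
  \<open>b2\<close> it becomes the set \<open>F\<close>.\<close>

definition reach :: "'a set \<Rightarrow> 'a \<Rightarrow> 'a set" where
  "reach N c = {v. \<exists>xs. successively E xs \<and> xs \<noteq> [] \<and> hd xs = c \<and> last xs = v \<and> set xs \<subseteq> N}"

lemma reach_subset: "reach N c \<subseteq> N"
  by (auto simp: reach_def)

lemma reach_refl: "c \<in> N \<Longrightarrow> c \<in> reach N c"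
  unfolding reach_def by (intro CollectI exI[of _ "[c]"]) auto

lemma reach_step:
  assumes "x \<in> reach N c" "E x y" "y \<in> N"
  shows "y \<in> reach N c"
proof -
  obtain xs where "successively E xs" "xs \<noteq> []" "hd xs = c" "last xs = x" "set xs \<subseteq> N"
    using assms by (auto simp: reach_def)
  then show ?thesis
    unfolding reach_def using assms
    by (intro CollectI exI[of _ "xs @ [y]"]) (auto simp: successively_append_iff)
qed

lemma walk_in_reach:
  assumes "successively E xs" "xs \<noteq> []" "hd xs \<in> reach N c" "set xs \<subseteq> N"
  shows "set xs \<subseteq> reach N c"
  using assms
proof (induction xs)
  case (Cons x xs)
  then show ?case using reach_step[of x N c "hd xs"] by (cases xs) auto
qed simp

lemma connected_in_reach: "connected_in (reach N c)"
  unfolding connected_in_def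
proof (intro ballI)
  fix x y assume "x \<in> reach N c" "y \<in> reach N c"
  then obtain xs ys where
    xs: "successively E xs" "xs \<noteq> []" "hd xs = c" "last xs = x" "set xs \<subseteq> N" and
    ys: "successively E ys" "ys \<noteq> []" "hd ys = c" "last ys = y" "set ys \<subseteq> N"
    unfolding reach_def by blast
  have "c \<in> N" using xs by (metis hd_in_set subsetD)
  then have c: "c \<in> reach N c" by (rule reach_refl)
  have sub: "set xs \<subseteq> reach N c" "set ys \<subseteq> reach N c"
    using walk_in_reach[of xs N c] walk_in_reach[of ys N c] xs ys c by auto
  have "successively E (rev xs)" using xs sym by (simp add: successively_mono)
  moreover have "successively E (tl ys)" "tl ys \<noteq> [] \<Longrightarrow> E c (hd (tl ys))"
    using ys by (cases ys; auto simp: successively_Cons)+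
  ultimately have "successively E (rev xs @ tl ys)"
    using xs by (auto simp: successively_append_iff last_rev)
  moreover have "last (rev xs @ tl ys) = y" using xs ys by (cases ys) (auto simp: last_rev)
  moreover have "set (rev xs @ tl ys) \<subseteq> reach N c" using sub ys by (cases ys) auto
  moreover have "rev xs @ tl ys \<noteq> []" "hd (rev xs @ tl ys) = x" using xs by (auto simp: hd_rev)
  ultimately show "\<exists>zs. successively E zs \<and> zs \<noteq> [] \<and> hd zs = x \<and> last zs = y \<and> set zs \<subseteq> reach N c"
    by blast
qed

end

section \<open>The possible exits from a connected set \<open>F\<close> that misses
  \<open>b1\<close> and \<open>b2\<close>\<close>

context prism_free_graph
begin

text \<open>This is \<open>hub_meets_hole\<close> for the hole formed by the path and the edge
  \<open>b1 b2\<close>. The link \<open>X\<close> is a shortest path in \<open>F\<close> from a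
  vertex with a neighbour on the path to a neighbour of \<open>w\<close>.\<close>

lemma hub_meets_path:
  assumes b: "E b1 b2" and w: "E w b1" "E w b2"
    and F: "connected_in F" "\<forall>f\<in>F. f \<noteq> b1 \<and> f \<noteq> b2 \<and> \<not> E f b1 \<and> \<not> E f b2"
    and wF: "f0 \<in> F" "E w f0"
    and y: "E y1 b1" "\<not> E y1 b2" "E y2 b2" "\<not> E y2 b1"
    and P: "induced_path E (y1 # p @ [y2])" "set p \<subseteq> F" "p \<noteq> []"
  shows "\<exists>y\<in>set (y1 # p @ [y2]). E w y"
proof (rule ccontr)
  assume miss: "\<not> ?thesis"
  let ?P = "y1 # p @ [y2]"
  have pF: "hd p \<in> F" "E (hd p) y1"
    using P sym by (auto simp: induced_path_Cons_iff)
  have pF2: "last p \<in> F" "E (last p) y2"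
    using P(2,3) induced_path_appendD(4)[of "y1 # p" "[y2]" "last p" y2] P(1) by auto
  have y': "E b1 y1" "\<not> E b2 y1" "E b2 y2" "\<not> E b1 y2" "y1 \<noteq> b1" "y1 \<noteq> b2" "y2 \<noteq> b1" "y2 \<noteq> b2"
    using y sym b pF pF2 F by auto
  have F': "\<forall>f\<in>F. \<not> E b1 f \<and> \<not> E b2 f" using F sym by blast
  obtain X where X: "induced_path E X" "set X \<subseteq> F"
    "\<forall>x\<in>set X. (\<exists>y\<in>set ?P. E x y) \<longleftrightarrow> x = hd X" "\<forall>x\<in>set X. E w x \<longleftrightarrow> x = last X"
    by (rule connected_in_path[OF F(1) pF(1) _ wF(1), of "\<lambda>f. \<exists>y\<in>set ?P. E f y" "E w"])
      (use pF wF in auto)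
  \<comment> \<open>Each vertex of \<open>?P\<close> has a neighbour on \<open>?P\<close>, so a
    common vertex can only be \<open>hd X\<close>. The next vertex of \<open>X\<close> would then
    also have a neighbour on \<open>?P\<close>; if there is no next vertex, \<open>w\<close> sees
    \<open>?P\<close>.\<close>
  have "set ?P \<inter> set X = {}"
  proof (rule ccontr)
    assume "set ?P \<inter> set X \<noteq> {}"
    then obtain x where x: "x \<in> set ?P" "x \<in> set X" by blast
    have "\<exists>y\<in>set ?P. E x y"
    proof -
      obtain i where i: "i < length ?P" "x = ?P!i" using x by (metis in_set_conv_nth)
      define k where "k = (if i = 0 then 1 else i - 1)"
      have "k < length ?P" "i = k + 1 \<or> k = i + 1" using i by (auto simp: k_def)
      moreover from this have "E (?P!i) (?P!k)" using P(1) i unfolding induced_path_def by blast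
      ultimately show ?thesis using i nth_mem by blast
    qed
    then have xh: "x = hd X" using X x by blast
    obtain x' X' where X': "X = x # x' # X'"
    proof (cases X rule: remdups_adj.cases)
      case 2
      then show ?thesis using X x miss by auto
    qed (use x xh that in auto)
    have "E x x'" "x \<noteq> x'"
      using induced_path_successively[OF X(1)] X(1) X' by (simp_all add: induced_path_def)
    then have "E x' x" "x' \<in> set X" "x' \<noteq> hd X" using sym X' by auto
    then show False using X(3) x by blast
  qed
  moreover have "w \<notin> F" using F w by blast
  then have "w \<notin> set X" using X by blast
  moreover have "w \<notin> set ?P" using w y P F \<open>w \<notin> F\<close> by auto
  ultimately have "\<exists>y\<in>set ?P. E w y"
    using X F F' y y' P w b
    by (intro hub_meets_hole[OF P(1), of b1 b2 w X]) auto
  then show False using miss by blast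
qed

lemma opposite_hubs_aux:
  assumes b: "E b1 b2" and a: "E a b1" "E a b2" and d: "E d b1" "E d b2" and ad: "a \<noteq> d" "\<not> E a d"
    and y2: "E y2 b2" "\<not> E y2 b1" "E y2 d" "\<not> E y2 a"
    and R: "induced_path E R" "\<forall>r\<in>set R. r \<noteq> b1 \<and> r \<noteq> b2 \<and> \<not> E r b1 \<and> \<not> E r b2 \<and> \<not> E d r"
      "\<forall>r\<in>set R. E a r \<longleftrightarrow> r = hd R" "\<forall>r\<in>set R. E y2 r \<longleftrightarrow> r = last R"
  shows False
proof -
  have ne: "R \<noteq> []" using R by auto
  have R': "\<forall>r\<in>set R. \<not> E b1 r \<and> \<not> E b2 r" using R sym by blast
  have a': "E b1 a" "E b2 a" "E b1 d" "E b2 d" "E b2 y2" "\<not> E b1 y2" "E b2 b1" "\<not> E a y2" "\<not> E d a" "E d y2"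
    using a d y2 b ad sym by blast+
  have neq: "a \<noteq> y2" "d \<noteq> y2" "b1 \<noteq> y2" "b2 \<noteq> y2" "a \<notin> set R" "d \<notin> set R" "y2 \<notin> set R"
     "a \<noteq> b1" "a \<noteq> b2" "d \<noteq> b1" "d \<noteq> b2"
    using a d y2 R b a' by auto
  have 1: "induced_path E (R @ [y2])" using R neq by (intro induced_path_snocI) auto
  have 2: "induced_path E (a # R @ [y2])" using 1 R neq a' ne by (intro induced_path_ConsI) auto
  have 3: "induced_path E ((a # R @ [y2]) @ [d])" using 2 R neq a' ne by (intro induced_path_snocI) auto
  have "odd (length (a # R @ [y2]))"
    using R R' neq a' ne by (intro hole[OF 2, of b2]) (auto simp: Suc_le_eq)
  moreover have "odd (length ((a # R @ [y2]) @ [d]))"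
    using R R' neq a' ne by (intro hole[OF 3, of b1]) (auto simp: Suc_le_eq)
  ultimately show False by simp
qed

text \<open>The path \<open>R\<close> for \<open>opposite_hubs_aux\<close> must miss
  \<open>d\<close>. It is cut from \<open>X\<close> followed by the rest of \<open>p\<close>:
  \<open>d\<close> sees nothing on \<open>p\<close> and at most \<open>hd X\<close> on
  \<open>X\<close>, but \<open>hd X\<close> is a neighbour of \<open>a\<close>, and a common
  neighbour of \<open>a\<close> and \<open>d\<close> in \<open>F\<close> would form a C4 with
  \<open>b1\<close>.\<close>

lemma opposite_hubs_aux2:
  assumes b: "E b1 b2" and a: "E a b1" "E a b2" and d: "E d b1" "E d b2" and ad: "a \<noteq> d" "\<not> E a d"
    and F: "\<forall>f\<in>F. f \<noteq> b1 \<and> f \<noteq> b2 \<and> \<not> E f b1 \<and> \<not> E f b2"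
    and y2: "E y2 b2" "\<not> E y2 b1" "E y2 d" "\<not> E y2 a"
    and p: "induced_path E p" "set p \<subseteq> F" "\<forall>x\<in>set p. \<not> E d x" "E y2 (last p)"
    and X: "induced_path E X" "set X \<subseteq> F" "\<forall>x\<in>set X. E a x \<or> E d x \<longleftrightarrow> x = hd X" "E a (hd X)" "last X \<in> set p"
  shows False
proof -
  have ne: "X \<noteq> []" "p \<noteq> []" using X p by auto
  have common: "\<not> E d x" if "x \<in> F" "E a x" for x
  proof
    assume "E d x"
    have "b1 \<noteq> x" "\<not> E b1 x" using F that sym by blast+
    then show False
      using C4[of a b1 d x] \<open>E d x\<close> that a d ad sym by blast
  qed
  obtain p1 p2 where split: "p = p1 @ last X # p2" using X by (meson split_list)
  have "successively E (last X # p2)"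
    using induced_path_successively[OF p(1)] split by (simp add: successively_append_iff)
  then have walk: "successively E (X @ p2)"
    using induced_path_successively[OF X(1)] ne by (auto simp: successively_append_iff successively_Cons)
  have "last (X @ p2) = last p" using split ne by auto
  then obtain R where R: "induced_path E R" "set R \<subseteq> set (X @ p2)"
    "\<forall>r\<in>set R. E a r \<longleftrightarrow> r = hd R" "\<forall>r\<in>set R. E y2 r \<longleftrightarrow> r = last R"
    by (rule_tac walk_imp_induced_path[OF walk, of "E a" "E y2"]) (use ne X p in auto)
  have nd: "\<not> E d r" if "r \<in> set R" for r
  proof (cases "r \<in> set X")
    case True
    then have "E d r \<Longrightarrow> r = hd X" using X by blast
    moreover have "hd X \<in> F" using X ne hd_in_set by blast
    ultimately show ?thesis using X common[of "hd X"] by blast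
  next
    case False
    then show ?thesis using that R p split by auto
  qed
  have "set R \<subseteq> F" using R X p split by auto
  then show False using opposite_hubs_aux[OF b a d ad y2 R(1) _ R(3,4)] F nd by blast
qed

lemma opposite_ends:
  assumes b: "E b1 b2" and y: "E y1 b1" "\<not> E y1 b2" "E y2 b2" "\<not> E y2 b1" and ne: "y1 \<noteq> b2" "y2 \<noteq> b1"
  shows "y1 \<noteq> y2" "\<not> E y1 y2"
proof -
  show "y1 \<noteq> y2" using y by auto
  show "\<not> E y1 y2"
  proof
    assume "E y1 y2"
    then show False using C4[of y1 y2 b2 b1] y b ne sym by blast
  qed
qed

text \<open>Evenness is the parity of the hole that \<open>b2\<close> and \<open>b1\<close>
  complete. The exit lemmas compare their other holes with it.\<close>

lemma path_between_ends:
  assumes b: "E b1 b2"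
    and F: "connected_in F" "\<forall>f\<in>F. f \<noteq> b1 \<and> f \<noteq> b2 \<and> \<not> E f b1 \<and> \<not> E f b2"
    and y: "E y1 b1" "\<not> E y1 b2" "E y2 b2" "\<not> E y2 b1" "y1 \<noteq> b2" "y2 \<noteq> b1"
    and yF: "\<exists>f\<in>F. E y1 f" "\<exists>f\<in>F. E y2 f"
  obtains p where "induced_path E (y1 # p @ [y2])" "set p \<subseteq> F" "p \<noteq> []" "even (length p)"
proof -
  obtain p where p: "induced_path E p" "set p \<subseteq> F" "\<forall>x\<in>set p. E y1 x \<longleftrightarrow> x = hd p" "\<forall>x\<in>set p. E y2 x \<longleftrightarrow> x = last p"
    using yF connected_in_path[OF F(1), of _ "E y1" _ "E y2"] by blast
  have ne: "p \<noteq> []" using p by auto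
  have F': "\<forall>f\<in>F. \<not> E b1 f \<and> \<not> E b2 f" using F sym by blast
  have yy: "y1 \<noteq> y2" "\<not> E y1 y2" "\<not> E y2 y1" using opposite_ends[OF b y] sym by blast+
  have y': "E b1 y1" "\<not> E b2 y1" "E b2 y2" "\<not> E b1 y2" "y1 \<noteq> b1" "y2 \<noteq> b2" "E b2 b1"
    using y sym b by auto
  have yp: "y1 \<notin> set p" "y2 \<notin> set p" using p F y by auto
  have 1: "induced_path E (p @ [y2])" using p yp by (intro induced_path_snocI) auto
  have 2: "induced_path E (y1 # p @ [y2])" using 1 p yp yy ne by (intro induced_path_ConsI) auto
  have 3: "induced_path E ((y1 # p @ [y2]) @ [b2])"
    using 2 p yp yy y' y F F' ne by (intro induced_path_snocI) auto
  have "odd (length ((y1 # p @ [y2]) @ [b2]))"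
    using p yp yy y' y F F' ne b by (intro hole[OF 3, of b1]) auto
  then show ?thesis using that[OF 2] p ne by simp
qed

lemma no_opposite_hubs:
  assumes b: "E b1 b2" and a: "E a b1" "E a b2" and d: "E d b1" "E d b2" and ad: "a \<noteq> d" "\<not> E a d"
    and F: "connected_in F" "\<forall>f\<in>F. f \<noteq> b1 \<and> f \<noteq> b2 \<and> \<not> E f b1 \<and> \<not> E f b2"
    and aF: "\<exists>f\<in>F. E a f" and dF: "\<exists>f\<in>F. E d f"
    and y: "E y1 b1" "\<not> E y1 b2" "E y2 b2" "\<not> E y2 b1" "y1 \<noteq> b2" "y2 \<noteq> b1"
    and yF: "\<exists>f\<in>F. E y1 f" "\<exists>f\<in>F. E y2 f"
  shows False
proof -
  obtain p where p: "induced_path E (y1 # p @ [y2])" "set p \<subseteq> F" "p \<noteq> []"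
    by (rule path_between_ends[OF b F y yF]) (rule that)
  let ?P = "y1 # p @ [y2]"
  have F': "\<forall>f\<in>F. \<not> E b1 f \<and> \<not> E b2 f" using F sym by blast
  have y': "E b1 y1" "\<not> E b2 y1" "E b2 y2" "\<not> E b1 y2" "y1 \<noteq> b1" "y2 \<noteq> b2" "E b2 b1"
    using y sym b by auto
  have aP: "a \<notin> set ?P" "d \<notin> set ?P" using a d y F p by auto
  have hits: "\<exists>x\<in>set ?P. E a x" "\<exists>x\<in>set ?P. E d x"
    using hub_meets_path[OF b a F _ _ y(1-4) p] hub_meets_path[OF b d F _ _ y(1-4) p] aF dF by blast+
  have pi: "induced_path E p"
    using induced_path_appendD(1)[of p "[y2]"] induced_path_appendD(2)[of "[y1]" "p @ [y2]"] p by simp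
  have pends: "E y1 (hd p)" "E y2 (last p)"
    using induced_path_appendD(4)[of "y1 # p" "[y2]" "last p" y2]
      induced_path_appendD(4)[of "[y1]" "p @ [y2]" y1 "hd p"] p sym by auto
  have yy: "y1 \<noteq> y2" using opposite_ends[OF b y] by blast
  have key: False
    if z: "\<forall>x\<in>set ?P. (E a' x \<longleftrightarrow> x = y1) \<and> (E d' x \<longleftrightarrow> x = y2)"
      and ad': "E a' b1" "E a' b2" "E d' b1" "E d' b2" "a' \<noteq> d'" "\<not> E a' d'" "\<exists>f\<in>F. E a' f" for a' d'
  proof -
    have y1p: "y1 \<notin> set p" "y2 \<notin> set p" using p by (auto simp: induced_path_def)
    have adp: "\<forall>x\<in>set p. \<not> E d' x" "\<forall>x\<in>set p. \<not> E a' x" using z y1p by auto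
    have yad: "E y2 d'" "\<not> E y2 a'" "E y1 a'" "\<not> E y1 d'" using z sym yy by auto
    obtain f where f: "f \<in> F" "E a' f" using ad' by blast
    have hp: "hd p \<in> F" "hd p \<in> set p" using p by auto
    \<comment> \<open>Neither hub sees \<open>p\<close>, so a path from a hub to \<open>p\<close> is
      sought in \<open>F\<close>. It starts at a neighbour of either hub, whichever is nearer to
      \<open>p\<close>, so no later vertex sees a hub. If it starts at \<open>d'\<close>, the mirror
      image applies, with \<open>b1\<close> and \<open>b2\<close> exchanged and \<open>p\<close>
      reversed.\<close>
    obtain X where X: "induced_path E X" "set X \<subseteq> F"
      "\<forall>x\<in>set X. E a' x \<or> E d' x \<longleftrightarrow> x = hd X" "\<forall>x\<in>set X. x \<in> set p \<longleftrightarrow> x = last X"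
      by (rule connected_in_path[OF F(1) f(1) _ hp(1), of "\<lambda>x. E a' x \<or> E d' x" "\<lambda>x. x \<in> set p"])
        (use f hp in auto)
    have Xne: "X \<noteq> []" using X by auto
    then have XX: "E a' (hd X) \<or> E d' (hd X)" "last X \<in> set p"
      using X hd_in_set[OF Xne] last_in_set[OF Xne] by blast+
    have da: "d' \<noteq> a'" "\<not> E d' a'" using ad' sym by blast+
    from XX(1) show False
    proof
      assume "E a' (hd X)"
      then show False
        using opposite_hubs_aux2[OF b ad'(1-6) F(2) y(3,4) yad(1,2) pi p(2) adp(1) pends(2) X(1-3)] XX by blast
    next
      assume h: "E d' (hd X)"
      have X3: "\<forall>x\<in>set X. E d' x \<or> E a' x \<longleftrightarrow> x = hd X" using X(3) by blast
      have F2: "\<forall>f\<in>F. f \<noteq> b2 \<and> f \<noteq> b1 \<and> \<not> E f b2 \<and> \<not> E f b1" using F by blast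
      show False
        by (rule opposite_hubs_aux2[OF y'(7) ad'(4,3,2,1) da F2 y(1,2) yad(3,4), of "rev p" X])
          (use pi p adp pends X X3 XX h in \<open>auto simp: last_rev\<close>)
    qed
  qed
  have "(\<forall>x\<in>set ?P. (E a x \<longleftrightarrow> x = hd ?P) \<and> (E d x \<longleftrightarrow> x = last ?P)) \<or>
    (\<forall>x\<in>set ?P. (E a x \<longleftrightarrow> x = last ?P) \<and> (E d x \<longleftrightarrow> x = hd ?P))"
  proof (rule two_hubs[OF p(1), of b1 b2])
    show "b1 \<notin> set ?P" "b2 \<notin> set ?P" using y y' p F by auto
    show "\<forall>x\<in>set ?P. E b1 x \<longleftrightarrow> x = hd ?P" "\<forall>x\<in>set ?P. E b2 x \<longleftrightarrow> x = last ?P"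
      using y' p F' yy by auto
  qed (use b a d ad aP hits in auto)
  then show False
  proof
    assume "\<forall>x\<in>set ?P. (E a x \<longleftrightarrow> x = hd ?P) \<and> (E d x \<longleftrightarrow> x = last ?P)"
    then show False using key[of a d] a d ad aF by simp
  next
    assume "\<forall>x\<in>set ?P. (E a x \<longleftrightarrow> x = last ?P) \<and> (E d x \<longleftrightarrow> x = hd ?P)"
    moreover have "\<not> E d a" using ad sym by blast
    ultimately show False using key[of d a] a d ad dF by simp
  qed
qed

text \<open>With \<open>z\<close> a path in \<open>F\<close> from \<open>a\<close> to
  \<open>s1\<close>, the hole \<open>b1\<close>, \<open>a\<close>, \<open>z\<close>,
  \<open>s1\<close> makes \<open>z\<close> odd, and \<open>b2\<close>, \<open>a\<close>,
  \<open>z\<close>, \<open>s1\<close>, \<open>\<sigma>\<close> then makes \<open>\<sigma>\<close>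
  even. The path \<open>p\<close> from \<open>s1\<close> to \<open>y2\<close> is even, so
  \<open>b2\<close>, \<open>y2\<close>, \<open>p\<close> backwards, \<open>s1\<close>,
  \<open>\<sigma>\<close> has odd length. The last hole requires \<open>y2\<close> to miss
  \<open>\<sigma>\<close>; otherwise \<open>y2\<close> sees \<open>a\<close>, and parity is replaced
  by \<open>two_hubs\<close>.\<close>

lemma no_one_sided_exit:
  assumes b: "E b1 b2" and a: "E a b1" "E a b2"
    and F: "connected_in F" "\<forall>f\<in>F. f \<noteq> b1 \<and> f \<noteq> b2 \<and> \<not> E f b1 \<and> \<not> E f b2"
    and aF: "\<exists>f\<in>F. E a f"
    and y2: "E y2 b2" "\<not> E y2 b1" "y2 \<noteq> b1" "\<exists>f\<in>F. E y2 f"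
    and s1: "E s1 b1" "\<not> E s1 b2" "s1 \<noteq> b2" "\<exists>f\<in>F. E s1 f"
    and \<sigma>: "induced_path E (s1 # \<sigma>)" "\<sigma> \<noteq> []" "a \<notin> set (s1 # \<sigma>)" "b2 \<notin> set \<sigma>"
      "\<forall>x\<in>set (s1 # \<sigma>). \<not> E a x" "\<forall>x\<in>set (s1 # \<sigma>). E b2 x \<longleftrightarrow> x = last \<sigma>"
      "\<forall>x\<in>set \<sigma>. x \<notin> F \<and> (\<forall>f\<in>F. \<not> E f x)" "b1 \<notin> set \<sigma>"
    and y\<sigma>: "\<not> E y2 a \<Longrightarrow> y2 \<notin> set \<sigma> \<and> (\<forall>x\<in>set \<sigma>. \<not> E y2 x)"
  shows False
proof -
  obtain p where p: "induced_path E (s1 # p @ [y2])" "set p \<subseteq> F" "p \<noteq> []" "even (length p)"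
    by (rule path_between_ends[OF b F s1(1,2) y2(1,2) s1(3) y2(3) s1(4) y2(4)]) (rule that)
  have F': "\<forall>f\<in>F. \<not> E b1 f \<and> \<not> E b2 f" using F sym by blast
  have sym': "E b1 s1" "\<not> E b2 s1" "E b2 y2" "\<not> E b1 y2" "s1 \<noteq> b1" "y2 \<noteq> b2" "E b2 b1" "E b1 a" "E b2 a"
    "a \<noteq> b1" "a \<noteq> b2" "b1 \<noteq> b2" "\<not> E s1 a"
    using y2 s1 sym b a \<sigma>(5) by auto
  have sy: "s1 \<noteq> y2" "\<not> E s1 y2" "\<not> E y2 s1"
    using opposite_ends[OF b s1(1,2) y2(1,2) s1(3) y2(3)] sym by blast+
  have \<sigma>i: "induced_path E \<sigma>" "s1 \<notin> set \<sigma>" "E s1 (hd \<sigma>)"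
    using \<sigma>(1,2) by (auto simp: induced_path_Cons_iff)
  obtain z where z: "induced_path E z" "set z \<subseteq> F" "\<forall>x\<in>set z. E a x \<longleftrightarrow> x = hd z" "\<forall>x\<in>set z. E s1 x \<longleftrightarrow> x = last z"
    using aF s1 connected_in_path[OF F(1), of _ "E a" _ "E s1"] by blast
  have zne: "z \<noteq> []" using z by auto
  have nF: "a \<notin> F" "s1 \<notin> F" "y2 \<notin> F" "b1 \<notin> F" "b2 \<notin> F" using F a s1 y2 by auto
  have zs: "induced_path E (z @ [s1])"
    using z nF by (intro induced_path_snocI) auto
  have azs: "induced_path E (a # z @ [s1])"
    using zs z nF \<sigma> zne by (intro induced_path_ConsI) auto
  have "odd (length (a # z @ [s1]))"
    using zne z nF sym' F' by (intro hole[OF azs, of b1]) (auto simp: Suc_le_eq)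
  then have oddz: "odd (length z)" by simp
  have z\<sigma>: "induced_path E (z @ s1 # \<sigma>)"
  proof (rule induced_path_appendI[OF z(1) \<sigma>(1)])
    show "set z \<inter> set (s1 # \<sigma>) = {}" using z nF \<sigma> by auto
    show "E x y \<longleftrightarrow> x = last z \<and> y = hd (s1 # \<sigma>)" if "x \<in> set z" "y \<in> set (s1 # \<sigma>)" for x y
    proof (cases "y = s1")
      case True
      then show ?thesis using z that sym_iff[of x s1] by simp
    next
      case False
      then have "\<not> E x y" using that z \<sigma>(7) by auto
      then show ?thesis using False by simp
    qed
  qed
  have az\<sigma>: "induced_path E (a # z @ s1 # \<sigma>)"
    using z\<sigma> z nF \<sigma> zne by (intro induced_path_ConsI) auto
  have l\<sigma>: "last (z @ s1 # \<sigma>) = last \<sigma>" "last (a # z @ s1 # \<sigma>) = last \<sigma>" "last \<sigma> \<in> set \<sigma>" using \<sigma>(2) by auto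
  have 1: "\<forall>x\<in>set (z @ s1 # \<sigma>). E b2 x \<longleftrightarrow> x = last (z @ s1 # \<sigma>)"
    using z F' \<sigma>(6,7) l\<sigma> by auto
  have "odd (length (a # z @ s1 # \<sigma>))"
  proof (rule hole[OF az\<sigma>, of b2])
    show "b2 \<notin> set (a # z @ s1 # \<sigma>)" using sym' nF z \<sigma> s1 by auto
    show "E b2 x \<longleftrightarrow> x = hd (a # z @ s1 # \<sigma>) \<or> x = last (a # z @ s1 # \<sigma>)" if "x \<in> set (a # z @ s1 # \<sigma>)" for x
    proof (cases "x = a")
      case False
      then have "x \<in> set (z @ s1 # \<sigma>)" using that by simp
      then show ?thesis using 1 l\<sigma> False by (metis list.sel(1))
    qed (use sym' in simp)
  qed (use zne in \<open>auto simp: Suc_le_eq\<close>)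
  then have odd\<sigma>: "even (length \<sigma>)" using oddz by simp
  show False
  proof (cases "y2 \<in> set \<sigma> \<or> (\<exists>x\<in>set \<sigma>. E y2 x)")
    case False
    have rp: "induced_path E (y2 # rev p)"
      using p(1,3) induced_path_appendD(2)[of "[s1]" "p @ [y2]"] by (metis append_is_Nil_conv append_Cons append_Nil induced_path_rev list.discI rev.simps(2) rev_append rev_rev_ident rev_singleton_conv)
    have s1p: "E s1 x \<longleftrightarrow> x = hd p" "s1 \<noteq> x" if "x \<in> set p" for x
      using that p by (auto simp: induced_path_Cons_iff)
    have 2: "induced_path E ((y2 # rev p) @ s1 # \<sigma>)"
    proof (rule induced_path_appendI[OF rp \<sigma>(1)])
      show "set (y2 # rev p) \<inter> set (s1 # \<sigma>) = {}" using p \<sigma> nF sy False by auto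
      show "E x y \<longleftrightarrow> x = last (y2 # rev p) \<and> y = hd (s1 # \<sigma>)" if "x \<in> set (y2 # rev p)" "y \<in> set (s1 # \<sigma>)" for x y
      proof -
        have l: "last (y2 # rev p) = hd p" "hd p \<in> F" using p by (auto simp: last_rev)
        have "x = y2 \<or> x \<in> set p" "y = s1 \<or> y \<in> set \<sigma>" using that by auto
        then consider "x = y2" | "x \<in> set p" "y = s1" | "x \<in> set p" "y \<in> set \<sigma>" by blast
        then show ?thesis
        proof cases
          case 1
          then have "\<not> E x y" "x \<noteq> hd p" using that False sy l nF by auto
          then show ?thesis using l by simp
        next
          case 2
          then show ?thesis using l s1p[of x] sym_iff[of x s1] by simp
        next
          case 3
          then have "\<not> E x y" "y \<noteq> s1" using \<sigma>(7) p \<sigma>i by auto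
          then show ?thesis by simp
        qed
      qed
    qed
    have "odd (length ((y2 # rev p) @ s1 # \<sigma>))"
    proof (rule hole[OF 2, of b2])
      show "b2 \<notin> set ((y2 # rev p) @ s1 # \<sigma>)" using sym' nF p \<sigma> s1 by auto
      show "E b2 x \<longleftrightarrow> x = hd ((y2 # rev p) @ s1 # \<sigma>) \<or> x = last ((y2 # rev p) @ s1 # \<sigma>)"
        if "x \<in> set ((y2 # rev p) @ s1 # \<sigma>)" for x
      proof -
        consider "x = y2" | "x \<in> set p" "x \<noteq> y2" | "x \<in> set (s1 # \<sigma>)" "x \<noteq> y2" using \<open>x \<in> _\<close> by auto
        then show ?thesis
        proof cases
          case 2
          then have "\<not> E b2 x" "x \<noteq> last \<sigma>" using F' p l\<sigma> \<sigma>(7) by auto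
          then show ?thesis using 2 \<sigma>(2) by simp
        next
          case 3
          then have "E b2 x \<longleftrightarrow> x = last \<sigma>" using \<sigma>(6) by blast
          then show ?thesis using 3 \<sigma>(2) by simp
        qed (use sym' in simp)
      qed
    qed (use p in \<open>auto simp: Suc_le_eq\<close>)
    then show False using p odd\<sigma> by simp
  next
    case True
    then have ya: "E y2 a" using y\<sigma> by blast
    have y2\<sigma>: "y2 \<notin> set \<sigma>"
      using ya \<sigma>(5) sym by auto
    then have "\<exists>x\<in>set \<sigma>. E y2 x" using True by blast
    then have h2: "\<exists>x\<in>set (z @ s1 # \<sigma>). E y2 x" by auto
    have h1: "\<exists>x\<in>set (z @ s1 # \<sigma>). E b1 x" using sym' by auto
    \<comment> \<open>The path is closed by the edge \<open>a b2\<close>, with the nonadjacent hubs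
      \<open>b1\<close> and \<open>y2\<close>. The exceptional outcome confines \<open>b1\<close> to
      an end of the path, whereas its neighbour \<open>s1\<close> is an inner vertex.\<close>
    have "(\<forall>x\<in>set (z @ s1 # \<sigma>). (E b1 x \<longleftrightarrow> x = hd (z @ s1 # \<sigma>)) \<and> (E y2 x \<longleftrightarrow> x = last (z @ s1 # \<sigma>))) \<or>
      (\<forall>x\<in>set (z @ s1 # \<sigma>). (E b1 x \<longleftrightarrow> x = last (z @ s1 # \<sigma>)) \<and> (E y2 x \<longleftrightarrow> x = hd (z @ s1 # \<sigma>)))"
    proof (rule two_hubs[OF z\<sigma>, of a b2])
      show "a \<notin> set (z @ s1 # \<sigma>)" "b2 \<notin> set (z @ s1 # \<sigma>)" "b1 \<notin> set (z @ s1 # \<sigma>)" "y2 \<notin> set (z @ s1 # \<sigma>)"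
        using nF z \<sigma> s1 sym' sy y2\<sigma> by auto
      show "2 \<le> length (z @ s1 # \<sigma>)" using zne by (auto simp: Suc_le_eq)
      show "\<forall>x\<in>set (z @ s1 # \<sigma>). E a x \<longleftrightarrow> x = hd (z @ s1 # \<sigma>)"
        using z \<sigma> zne nF by auto
      show "\<not> E b1 y2" using sym' by blast
    qed (use 1 h1 h2 a b ya y2 sym' in blast)+
    then have "s1 = hd (z @ s1 # \<sigma>) \<or> s1 = last (z @ s1 # \<sigma>)" using sym' by auto
    moreover have "s1 \<noteq> last (z @ s1 # \<sigma>)" using l\<sigma> \<sigma>i by metis
    moreover have "hd (z @ s1 # \<sigma>) \<in> F" using z zne by auto
    ultimately show False using nF by auto
  qed
qed

text \<open>Let \<open>g\<close> and \<open>h\<close> be the first and last neighbours of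
  \<open>a\<close> on \<open>p\<close>, with \<open>A\<close> before and \<open>C\<close> after
  them. The holes through \<open>a\<close> with \<open>b1\<close> and with \<open>b2\<close> make
  \<open>A\<close> and \<open>C\<close> even, so evenness of \<open>p\<close> forces
  \<open>g\<close> and \<open>h\<close> to differ. The route from \<open>g\<close> to
  \<open>h\<close> through \<open>\<tau>\<close> then settles whether they are adjacent.\<close>

lemma no_two_sided_exit:
  assumes b: "E b1 b2" and a: "E a b1" "E a b2"
    and F: "connected_in F" "\<forall>f\<in>F. f \<noteq> b1 \<and> f \<noteq> b2 \<and> \<not> E f b1 \<and> \<not> E f b2"
    and aF: "\<exists>f\<in>F. E a f"
    and y: "E y1 b1" "\<not> E y1 b2" "E y2 b2" "\<not> E y2 b1" "y1 \<noteq> b2" "y2 \<noteq> b1"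
    and yF: "\<exists>f\<in>F. E y1 f" "\<exists>f\<in>F. E y2 f"
    and \<tau>: "induced_path E (y1 # \<tau> @ [y2])" "a \<notin> set \<tau>" "b1 \<notin> set \<tau>"
      "\<forall>x\<in>set (y1 # \<tau> @ [y2]). \<not> E a x"
      "\<forall>x\<in>set \<tau>. x \<notin> F \<and> (\<forall>f\<in>F. \<not> E f x)"
  shows False
proof -
  obtain p where p: "induced_path E (y1 # p @ [y2])" "set p \<subseteq> F" "p \<noteq> []" "even (length p)"
    by (rule path_between_ends[OF b F y yF]) (rule that)
  let ?P = "y1 # p @ [y2]"
  have F': "\<forall>f\<in>F. \<not> E b1 f \<and> \<not> E b2 f" using F sym by blast
  have y': "E b1 y1" "\<not> E b2 y1" "E b2 y2" "\<not> E b1 y2" "y1 \<noteq> b1" "y2 \<noteq> b2" "E b2 b1" "E b1 a" "E b2 a"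
    using y sym b a by auto
  have yy: "y1 \<noteq> y2" "\<not> E y1 y2" "\<not> E y2 y1" using opposite_ends[OF b y] sym by blast+
  have nF: "a \<notin> F" "y1 \<notin> F" "y2 \<notin> F" "b1 \<notin> F" "b2 \<notin> F" using F a y by auto
  have nay: "\<not> E a y1" "\<not> E a y2" using \<tau> by auto
  have ayb: "a \<noteq> y1" "a \<noteq> y2" "a \<noteq> b1" "a \<noteq> b2" using a y by auto
  have \<tau>ne: "\<tau> \<noteq> []" using \<tau>(1) yy by (auto simp: induced_path_Cons_iff)
  have "\<exists>x\<in>set ?P. E a x" using hub_meets_path[OF b a F _ _ y(1-4) p(1-3)] aF by blast
  then have ex: "\<exists>x\<in>set p. E a x" using nay by auto
  obtain A g B where P1: "p = A @ g # B" "E a g" "\<forall>x\<in>set A. \<not> E a x"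
    using split_list_first_prop[OF ex] by blast
  obtain A' h' C' where P2: "p = A' @ h' # C'" "E a h'" "\<forall>x\<in>set C'. \<not> E a x"
    using split_list_last_prop[OF ex] by blast
  have dist: "distinct ?P" using p by (simp add: induced_path_def)
  have g: "h' \<in> set p" unfolding P2(1) by simp
  have sub: "set A \<subseteq> F" "set B \<subseteq> F" "g \<in> F" using P1(1) p(2) by auto
  have sub': "set C' \<subseteq> F" "h' \<in> F" using P2(1) p(2) by auto
  have evA: "even (length A)"
  proof -
    have 1: "induced_path E (y1 # A @ [g])"
      using induced_path_appendD(1)[of "y1 # A @ [g]" "B @ [y2]"] p P1 by simp
    have 2: "induced_path E ((y1 # A @ [g]) @ [a])"
      using 1 P1 nay ayb sub nF by (intro induced_path_snocI) auto
    have "odd (length ((y1 # A @ [g]) @ [a]))"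
      using y' F' sub nF ayb by (intro hole[OF 2, of b1]) auto
    then show ?thesis by simp
  qed
  have evC: "even (length C')"
  proof -
    have 0: "induced_path E (h' # C' @ [y2])"
      using induced_path_appendD(2)[of "y1 # A'" "h' # C' @ [y2]"] p P2 by simp
    have 1: "induced_path E (a # h' # C' @ [y2])"
      by (rule induced_path_ConsI[OF 0]) (use P2 nay ayb sub' nF in auto)
    have "odd (length (a # h' # C' @ [y2]))"
      using y' F' sub' nF ayb by (intro hole[OF 1, of b2]) auto
    then show ?thesis by simp
  qed
  show False
  proof (cases "\<exists>x\<in>set B. E a x")
    case False
    then have "h' \<notin> set A" "h' \<notin> set B" using P1 P2 by auto
    then have "h' = g" using g P1(1) by auto
    then have "A' @ g # C' = A @ g # B" using P1 P2 by simp
    then have "C' = B" using \<open>h' = g\<close> \<open>h' \<notin> set A\<close> \<open>h' \<notin> set B\<close>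
      by (auto simp: append_eq_append_conv2 Cons_eq_append_conv append_eq_Cons_conv)
    then have "length p = length A + length C' + 1" using P1(1) by simp
    then show False using p(4) evA evC by simp
  next
    case True
    then obtain M h C where B: "B = M @ h # C" "E a h" "\<forall>x\<in>set C. \<not> E a x"
      using split_list_last_prop[OF True] by blast
    have "(A @ g # M) @ h # C = A' @ h' # C'" using P1 P2 B by simp
    then have "C' = C"
      using P2(2,3) B by (auto simp: append_eq_append_conv2 Cons_eq_append_conv append_eq_Cons_conv)
    then have evC: "even (length C)" using evC by simp
    have PM: "?P = (y1 # A) @ [g] @ M @ [h] @ (C @ [y2])" using P1 B by simp
    have subC: "set C \<subseteq> F" "h \<in> F" "set M \<subseteq> F" using B sub by auto
    \<comment> \<open>\<open>?S @ \<tau> @ ?T\<close> goes from the neighbour of \<open>g\<close>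
      back to \<open>y1\<close>, through \<open>\<tau>\<close> to \<open>y2\<close>, and on to the
      neighbour of \<open>h\<close>.\<close>
    let ?S = "rev (y1 # A)" and ?T = "y2 # rev C"
    have S: "induced_path E (y1 # A)" and hC: "induced_path E (h # C @ [y2])"
      and T: "induced_path E (C @ [y2])" and gS: "induced_path E (y1 # A @ [g])"
      using induced_path_appendD(1)[of "y1 # A" "[g] @ M @ [h] @ (C @ [y2])"]
        induced_path_appendD(2)[of "y1 # A @ [g] @ M" "h # C @ [y2]"]
        induced_path_appendD(2)[of "y1 # A @ [g] @ M @ [h]" "C @ [y2]"]
        induced_path_appendD(1)[of "y1 # A @ [g]" "M @ [h] @ (C @ [y2])"] p(1) PM by simp_all
    have Tr: "induced_path E ?T" using T by (metis induced_path_rev rev.simps(2) rev_rev_ident)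
    have far: "\<not> E x z" if "x \<in> set (y1 # A)" "z \<in> set (M @ h # C @ [y2])" for x z
      using induced_path_appendD(4)[of "y1 # A" "[g] @ M @ [h] @ (C @ [y2])" x z] p(1) PM that dist
      by auto
    have \<tau>i: "induced_path E \<tau>"
      using induced_path_appendD(1)[of \<tau> "[y2]"] induced_path_appendD(2)[of "[y1]" "\<tau> @ [y2]"] \<tau>(1) \<tau>ne by simp
    have dist\<tau>: "distinct (y1 # \<tau> @ [y2])" using \<tau>(1) by (simp add: induced_path_def)
    have y1\<tau>: "E y1 x \<longleftrightarrow> x = hd \<tau>" if "x \<in> set \<tau>" for x
      using \<tau>(1) that \<tau>ne by (auto simp: induced_path_Cons_iff)
    have y2\<tau>: "E x y2 \<longleftrightarrow> x = last \<tau>" if "x \<in> set \<tau>" for x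
      using induced_path_appendD(4)[of "y1 # \<tau>" "[y2]" x y2] \<tau>(1) that \<tau>ne by auto
    have F\<tau>: "\<not> E f x" "\<not> E x f" if "f \<in> F" "x \<in> set \<tau>" for f x
      using \<tau>(5) that sym by blast+
    have \<tau>T: "induced_path E (\<tau> @ ?T)"
    proof (rule induced_path_appendI[OF \<tau>i Tr])
      show "set \<tau> \<inter> set ?T = {}" using dist\<tau> \<tau>(5) subC by auto
      show "E x z \<longleftrightarrow> x = last \<tau> \<and> z = hd ?T" if "x \<in> set \<tau>" "z \<in> set ?T" for x z
      proof (cases "z = y2")
        case False
        then have "\<not> E x z" using that subC F\<tau> by auto
        then show ?thesis using False by simp
      qed (use that y2\<tau> in simp)
    qed
    have S\<tau>T: "induced_path E (?S @ \<tau> @ ?T)"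
    proof (rule induced_path_appendI[OF _ \<tau>T])
      show "induced_path E ?S" using S by (simp del: rev.simps)
      show "set ?S \<inter> set (\<tau> @ ?T) = {}" using dist dist\<tau> \<tau>(5) sub subC nF PM by auto
      show "E x z \<longleftrightarrow> x = last ?S \<and> z = hd (\<tau> @ ?T)" if "x \<in> set ?S" "z \<in> set (\<tau> @ ?T)" for x z
      proof -
        have x: "x = y1 \<or> x \<in> set A \<and> x \<noteq> y1" using that nF sub by auto
        have z: "z \<in> set \<tau> \<or> z \<in> set ?T \<and> z \<noteq> hd \<tau>" using that \<tau>T \<tau>ne by (auto dest: induced_path_appendD(3))
        show ?thesis
        proof (cases "z \<in> set \<tau>")
          case True
          then show ?thesis using x sub F\<tau>(1)[of x z] y1\<tau>[of z] \<tau>ne by auto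
        next
          case False
          then have "\<not> E x z" using far[of x z] that by auto
          then show ?thesis using z False \<tau>ne by auto
        qed
      qed
    qed
    have gM: "g \<noteq> h" "g \<notin> set C" "h \<notin> set A" "g \<notin> set A" "h \<notin> set C" "g \<noteq> y1" "g \<noteq> y2" "h \<noteq> y1" "h \<noteq> y2"
      using dist PM by auto
    have gM': "E g x \<longleftrightarrow> x = hd (M @ h # C @ [y2])" if "x \<in> set (M @ h # C @ [y2])" for x
      using induced_path_appendD(4)[of "y1 # A @ [g]" "M @ [h] @ (C @ [y2])" g x] p(1) PM that by simp
    have hdM: "hd (M @ h # C @ [y2]) \<in> insert h (set M)" by (cases M) auto
    have gT: "\<not> E g x" if "x \<in> set (C @ [y2])" for x
      using gM'[of x] that hdM dist PM by auto
    have n1: "g \<notin> set (?S @ \<tau> @ ?T)" "h \<notin> set (?S @ \<tau> @ ?T)" using gM \<tau>(5) sub subC by auto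
    have hd1: "hd (?S @ \<tau> @ ?T) = last (y1 # A)" by (simp add: hd_rev)
    have g1: "E g x \<longleftrightarrow> x = hd (?S @ \<tau> @ ?T)" if x: "x \<in> set (?S @ \<tau> @ ?T)" for x
    proof -
      have lS: "last (y1 # A) \<in> set (y1 # A)" by (rule last_in_set) simp
      consider "x \<in> set (y1 # A)" | "x \<in> set \<tau> \<union> set ?T" "x \<notin> set (y1 # A)" using x by auto
      then show ?thesis
      proof cases
        case 1
        then have "E x g \<longleftrightarrow> x = last (y1 # A)"
          using induced_path_appendD(4)[of "y1 # A" "[g]" x g] gS by simp
        then show ?thesis using hd1 sym_iff[of x g] by metis
      next
        case 2
        then have "\<not> E g x" using F\<tau>(1) sub gT[of x] by auto
        then show ?thesis using 2 hd1 lS by metis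
      qed
    qed
    have h1: "E h x \<longleftrightarrow> x = last (?S @ \<tau> @ ?T)" if x: "x \<in> set (?S @ \<tau> @ ?T)" for x
    proof -
      have lT: "last (?S @ \<tau> @ ?T) = hd (C @ [y2])" "hd (C @ [y2]) \<in> set (C @ [y2])"
        by (auto simp: last_rev hd_append)
      have dT: "set (C @ [y2]) \<inter> (set ?S \<union> set \<tau>) = {}" using dist dist\<tau> PM \<tau>(5) subC by auto
      consider "x \<in> set (C @ [y2])" | "x \<in> set ?S \<union> set \<tau>" using x by auto
      then show "E h x \<longleftrightarrow> x = last (?S @ \<tau> @ ?T)"
      proof cases
        case 1
        then have "E h x \<longleftrightarrow> x = hd (C @ [y2])" using hC induced_path_Cons_iff[of "C @ [y2]" h] by blast
        then show ?thesis using lT by metis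
      next
        case 2
        have "\<not> E h x" using 2 F\<tau>(1) subC far[of x h] sym by auto
        then show ?thesis using 2 lT dT by auto
      qed
    qed
    show False
    proof (cases "M = []")
      \<comment> \<open>As \<open>g\<close> and \<open>h\<close> are nonadjacent, \<open>a\<close>
        closes the route between them to a hole, which makes \<open>\<tau>\<close> odd. The hole
        formed by \<open>p\<close> and \<open>\<tau>\<close> with \<open>y1\<close> and
        \<open>y2\<close> makes it even.\<close>
      case False
      have ngh: "\<not> E g h" "\<not> E h g"
        using gM'[of h] False sym[of h g] dist PM by (cases M; auto)+
      have 1: "induced_path E (g # ?S @ \<tau> @ ?T)"
        by (rule induced_path_ConsI[OF S\<tau>T n1(1) g1])
      have 2: "induced_path E ((g # ?S @ \<tau> @ ?T) @ [h])"
      proof (rule induced_path_snocI[OF 1])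
        show "h \<notin> set (g # ?S @ \<tau> @ ?T)" using n1 gM by auto
        fix x assume x: "x \<in> set (g # ?S @ \<tau> @ ?T)"
        have l: "last (g # ?S @ \<tau> @ ?T) = last (?S @ \<tau> @ ?T)" "last (?S @ \<tau> @ ?T) \<in> set (?S @ \<tau> @ ?T)"
          by (simp, rule last_in_set, simp)
        show "E h x \<longleftrightarrow> x = last (g # ?S @ \<tau> @ ?T)"
        proof (cases "x = g")
          case True
          then show ?thesis using ngh l n1 by metis
        next
          case False
          then have "x \<in> set (?S @ \<tau> @ ?T)" using x by simp
          then show ?thesis using h1 l by metis
        qed
      qed
      have "odd (length ((g # ?S @ \<tau> @ ?T) @ [h]))"
      proof (rule hole[OF 2, of a])
        show "a \<notin> set ((g # ?S @ \<tau> @ ?T) @ [h])" using nF sub subC ayb \<tau> by auto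
        show "E a x \<longleftrightarrow> x = hd ((g # ?S @ \<tau> @ ?T) @ [h]) \<or> x = last ((g # ?S @ \<tau> @ ?T) @ [h])"
          if "x \<in> set ((g # ?S @ \<tau> @ ?T) @ [h])" for x
        proof -
          have "x = g \<or> x = h \<or> x \<noteq> g \<and> x \<noteq> h \<and> \<not> E a x" using that P1 B nay \<tau>(4) n1 by auto
          then show ?thesis using P1 B by auto
        qed
      qed simp
      then have odd\<tau>: "odd (length \<tau>)" using evA evC by simp
      have "induced_path E (p @ [y2])"
        using induced_path_appendD(2)[of "[y1]" "p @ [y2]"] p(1) by simp
      moreover have r\<tau>: "induced_path E (rev \<tau>)" using \<tau>i by simp
      ultimately have 3: "induced_path E ((p @ [y2]) @ rev \<tau>)"
      proof (rule induced_path_appendI)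
        show "set (p @ [y2]) \<inter> set (rev \<tau>) = {}" using dist\<tau> \<tau>(5) p(2) by auto
        show "E x z \<longleftrightarrow> x = last (p @ [y2]) \<and> z = hd (rev \<tau>)" if "x \<in> set (p @ [y2])" "z \<in> set (rev \<tau>)" for x z
        proof (cases "x = y2")
          case True
          then show ?thesis using that y2\<tau>[of z] sym_iff[of y2 z] by (simp add: hd_rev)
        next
          case False
          then have "\<not> E x z" using that F\<tau>(1) p(2) by auto
          then show ?thesis using False by simp
        qed
      qed
      have "odd (length ((p @ [y2]) @ rev \<tau>))"
      proof (rule hole[OF 3, of y1])
        show "y1 \<notin> set ((p @ [y2]) @ rev \<tau>)" using dist dist\<tau> by auto
        show "3 \<le> length ((p @ [y2]) @ rev \<tau>)" using p(3) \<tau>ne by (cases p; cases \<tau>) auto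
        have hl: "hd ((p @ [y2]) @ rev \<tau>) = hd p" "last ((p @ [y2]) @ rev \<tau>) = hd \<tau>"
          using p(3) \<tau>ne by (auto simp: last_rev)
        show "E y1 x \<longleftrightarrow> x = hd ((p @ [y2]) @ rev \<tau>) \<or> x = last ((p @ [y2]) @ rev \<tau>)"
          if x: "x \<in> set ((p @ [y2]) @ rev \<tau>)" for x
          unfolding hl
        proof -
          have hF: "hd p \<in> F" "hd \<tau> \<in> set \<tau>" "hd \<tau> \<notin> F" using p \<tau>ne \<tau>(5) by auto
          consider "x \<in> set p" | "x = y2" | "x \<in> set \<tau>" using x by auto
          then show "E y1 x \<longleftrightarrow> x = hd p \<or> x = hd \<tau>"
          proof cases
            case 1
            then have "E y1 x \<longleftrightarrow> x = hd p" using p(1,3) by (auto simp: induced_path_Cons_iff)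
            moreover have "x \<noteq> hd \<tau>" using 1 p(2) hF by auto
            ultimately show ?thesis by blast
          next
            case 2
            then show ?thesis using yy hF nF dist\<tau> by auto
          next
            case 3
            then have "x \<noteq> hd p" using hF \<tau>(5) by auto
            then show ?thesis using y1\<tau>[OF 3] by blast
          qed
        qed
      qed
      then show False using odd\<tau> p(4) by simp
    next
      case True
      have ghE: "E g h" using gM'[of h] True by simp
      \<comment> \<open>The edge \<open>g h\<close> now plays the part of \<open>b1 b2\<close>, and
        the single vertex \<open>b1\<close>, which sees \<open>a\<close> and \<open>y1\<close> but
        neither \<open>g\<close> nor \<open>h\<close>, is the link.\<close>
      have "\<exists>x\<in>set (?S @ \<tau> @ ?T). E a x"
      proof (rule hub_meets_hole[OF S\<tau>T, of g h a "[b1]"])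
        show "2 \<le> length (?S @ \<tau> @ ?T)" by simp
        show "\<forall>x\<in>set [b1]. (\<exists>y\<in>set (?S @ \<tau> @ ?T). E x y) \<longleftrightarrow> x = hd [b1]" using y' by auto
        show "set (?S @ \<tau> @ ?T) \<inter> set [b1] = {}" using y y' \<tau>(3) sub subC nF by auto
        show "a \<notin> set (?S @ \<tau> @ ?T)" using nF sub subC ayb \<tau> by auto
        show "\<forall>x\<in>set [b1]. x \<noteq> g \<and> x \<noteq> h \<and> \<not> E x g \<and> \<not> E x h" using nF F' sub subC by auto
        show "\<forall>x\<in>set [b1]. E a x \<longleftrightarrow> x = last [b1]" using a by auto
        show "a \<notin> set [b1]" using ayb by auto
      qed (use n1 g1 h1 ghE P1(2) B(2) in auto)
      then show False using P1 B nay \<tau>(4) by auto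
    qed
  qed
qed

end

lemma successively_all:
  assumes "successively E xs" "x \<in> set xs" "Q x"
    and "\<And>x y. x \<in> set xs \<Longrightarrow> y \<in> set xs \<Longrightarrow> E x y \<Longrightarrow> Q x \<longleftrightarrow> Q y"
  shows "\<forall>y\<in>set xs. Q y"
proof -
  have "\<forall>y\<in>set xs. Q y = Q (hd xs)" using assms(1,4)
  proof (induction xs)
    case (Cons z xs)
    show ?case
    proof (cases xs)
      case (Cons w ws)
      then have "\<forall>y\<in>set xs. Q y = Q w" using Cons.IH Cons.prems by simp
      moreover have "Q z = Q w" using Cons.prems Cons by simp
      ultimately show ?thesis by simp
    qed simp
  qed simp
  then show ?thesis using assms(2,3) by blast
qed

section \<open>Exits on both sides and the contradiction for one paw\<close>

context prism_free_graph
begin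

text \<open>On a shortest path in \<open>D\<close> from \<open>c\<close> to a neighbour of
  \<open>b2\<close>, all vertices but the last avoid \<open>b1\<close>, \<open>b2\<close> and their
  neighbours, so they are reached from \<open>c\<close>. The last vertex is the exit; it differs
  from \<open>c\<close> because \<open>c\<close> misses \<open>b2\<close>.\<close>

lemma exit_vertex:
  assumes D: "connected_in D" "c \<in> D" "\<forall>v\<in>D. v \<noteq> b1 \<and> v \<noteq> b2 \<and> \<not> E v b1" "\<exists>f\<in>D. E b2 f" "\<not> E b2 c"
  obtains y where "E y b2" "\<not> E y b1" "y \<noteq> b1"
    "\<exists>f\<in>reach {v. v \<noteq> b1 \<and> v \<noteq> b2 \<and> \<not> E v b1 \<and> \<not> E v b2} c. E y f"
proof -
  let ?N = "{v. v \<noteq> b1 \<and> v \<noteq> b2 \<and> \<not> E v b1 \<and> \<not> E v b2}"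
  obtain ys where ys: "induced_path E ys" "set ys \<subseteq> D"
    "\<forall>y\<in>set ys. c = y \<longleftrightarrow> y = hd ys" "\<forall>y\<in>set ys. E b2 y \<longleftrightarrow> y = last ys"
    using D connected_in_path[OF D(1,2), of "\<lambda>y. c = y" _ "E b2"] by blast
  have ne: "ys \<noteq> []" using ys by auto
  then have hd: "hd ys = c" using ys hd_in_set by metis
  obtain bs y where split: "ys = bs @ [y]" using ne by (cases ys rule: rev_cases) auto
  have "E b2 y" using ys split by simp
  then have bne: "bs \<noteq> []" using hd split D(5) by auto
  have notlast: "v \<noteq> y" if "v \<in> set bs" for v
    using ys(1) that split by (auto simp: induced_path_def)
  have sub: "set bs \<subseteq> ?N"
  proof
    fix v assume v: "v \<in> set bs"
    then have "v \<in> set ys" using split by simp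
    then show "v \<in> ?N" using ys D(3) notlast[OF v] sym[of v b2] split by auto
  qed
  have hb: "hd bs = c" using hd split bne by simp
  then have "c \<in> ?N" using sub hd_in_set[OF bne] by blast
  then have "hd bs \<in> reach ?N c" unfolding hb by (rule reach_refl)
  moreover have suc: "successively E bs" "E (last bs) y"
    using induced_path_successively[OF ys(1)] split bne by (simp_all add: successively_append_iff)
  ultimately have "set bs \<subseteq> reach ?N c"
    by (intro walk_in_reach bne sub)
  then have "last bs \<in> reach ?N c" using bne last_in_set by blast
  moreover have "y \<in> D" using ys split by simp
  moreover have "E b2 y" using ys split by simp
  ultimately show ?thesis using that[of y] suc(2) D(3) sym by blast
qed

text \<open>Take a shortest path in \<open>D\<close> from the closed neighbourhood of
  \<open>F\<close> to a neighbour of \<open>b2\<close>. If no exit in \<open>D\<close> sees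
  \<open>b2\<close>, its first vertex \<open>s1\<close> sees \<open>b1\<close> only, and the rest
  has no contact with \<open>F\<close>, as \<open>no_one_sided_exit\<close> demands.\<close>

lemma unreached_side:
  fixes b1 b2 c
  defines "F \<equiv> reach {v. v \<noteq> b1 \<and> v \<noteq> b2 \<and> \<not> E v b1 \<and> \<not> E v b2} c"
  assumes b: "E b1 b2" and a: "E a b1" "E a b2" "E a c" and c: "c \<in> F"
    and D: "connected_in D" "\<forall>v\<in>D. v \<noteq> a \<and> \<not> E v a"
      "\<And>x y. x \<in> D \<Longrightarrow> E x y \<Longrightarrow> y \<noteq> a \<Longrightarrow> \<not> E y a \<Longrightarrow> y \<in> D"
      "\<exists>f\<in>D. E c f" "\<exists>f\<in>D. E b2 f"
    and y2: "E y2 b2" "\<not> E y2 b1" "y2 \<noteq> b1" "\<exists>f\<in>F. E y2 f"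
  shows "\<exists>v\<in>D. E v b2 \<and> (\<exists>f\<in>F. E v f)"
proof (rule ccontr)
  assume none: "\<not> ?thesis"
  let ?N = "{v. v \<noteq> b1 \<and> v \<noteq> b2 \<and> \<not> E v b1 \<and> \<not> E v b2}"
  have F: "connected_in F" "\<forall>f\<in>F. f \<noteq> b1 \<and> f \<noteq> b2 \<and> \<not> E f b1 \<and> \<not> E f b2"
    using connected_in_reach reach_subset[of ?N c] unfolding F_def by blast+
  obtain d0 where d0: "d0 \<in> D" "E c d0" using D by blast
  obtain e0 where e0: "e0 \<in> D" "E b2 e0" using D by blast
  have "d0 \<in> F \<or> (\<exists>f\<in>F. E d0 f)" using d0 c sym by blast
  then obtain ys where ys: "induced_path E ys" "set ys \<subseteq> D"
    "\<forall>y\<in>set ys. (y \<in> F \<or> (\<exists>f\<in>F. E y f)) \<longleftrightarrow> y = hd ys" "\<forall>y\<in>set ys. E b2 y \<longleftrightarrow> y = last ys"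
    using connected_in_path[OF D(1) d0(1) _ e0(1), of "\<lambda>y. y \<in> F \<or> (\<exists>f\<in>F. E y f)" "E b2"] e0(2) by blast
  obtain s1 \<sigma> where s: "ys = s1 # \<sigma>" using ys by (cases ys) auto
  have s1D: "s1 \<in> D" "s1 \<in> F \<or> (\<exists>f\<in>F. E s1 f)" using ys s by auto
  have ne: "\<sigma> \<noteq> []"
  proof
    assume "\<sigma> = []"
    then have "E s1 b2" using ys s sym by auto
    then show False using s1D none F by blast
  qed
  have \<sigma>i: "s1 \<notin> set \<sigma>" "E s1 (hd \<sigma>)" "hd \<sigma> \<in> set \<sigma>"
    using ys(1) s ne by (auto simp: induced_path_Cons_iff)
  have \<sigma>F: "\<forall>x\<in>set \<sigma>. x \<notin> F \<and> (\<forall>f\<in>F. \<not> E f x)"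
    using ys(3) s \<sigma>i sym by (metis list.sel(1) list.set_intros(2))
  \<comment> \<open>Otherwise \<open>hd \<sigma>\<close>, being adjacent to \<open>s1\<close>, would
    have a neighbour in \<open>F\<close>.\<close>
  then have s1F: "s1 \<notin> F" using \<sigma>i by blast
  then have s1N: "\<exists>f\<in>F. E s1 f" using s1D by blast
  have ab: "b1 \<notin> D" "b2 \<notin> D" "a \<notin> D" using D(2) a sym by blast+
  have ns: "\<not> E s1 b2" using none s1D s1N by blast
  have s1b: "E s1 b1"
  proof (rule ccontr)
    assume "\<not> E s1 b1"
    then have "s1 \<in> ?N" using ns ab s1D by auto
    moreover obtain f where "f \<in> F" "E s1 f" using s1N by blast
    ultimately have "s1 \<in> F" unfolding F_def using reach_step[of f ?N c s1] sym by blast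
    then show False using s1F by blast
  qed
  show False
  proof (rule no_one_sided_exit[OF b a(1,2) F _ y2 s1b ns _ s1N ys(1)[unfolded s] ne])
    show "\<exists>f\<in>F. E a f" using a c by blast
    show "s1 \<noteq> b2" "a \<notin> set (s1 # \<sigma>)" "b2 \<notin> set \<sigma>" "b1 \<notin> set \<sigma>" using ab s1D ys(2) s by auto
    show "\<forall>x\<in>set (s1 # \<sigma>). \<not> E a x" using D(2) ys(2) s sym by blast
    show "\<forall>x\<in>set (s1 # \<sigma>). E b2 x \<longleftrightarrow> x = last \<sigma>" using ys(4) s ne by simp
    \<comment> \<open>By \<open>none\<close>, \<open>y2\<close> is not in \<open>D\<close>. Since
      \<open>D\<close> is a full component of what remains after deleting the closed neighbourhood
      of \<open>a\<close>, an outside vertex that misses \<open>a\<close> has no neighbour in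
      \<open>D\<close>.\<close>
    show "y2 \<notin> set \<sigma> \<and> (\<forall>x\<in>set \<sigma>. \<not> E y2 x)" if "\<not> E y2 a"
    proof -
      have "y2 \<notin> D" using none y2 by blast
      moreover have "y2 \<noteq> a" using y2 a by blast
      ultimately have "\<not> E y2 x" if "x \<in> D" for x using D(3)[OF that, of y2] sym \<open>\<not> E y2 a\<close> by blast
      then show ?thesis using \<open>y2 \<notin> D\<close> ys(2) s by auto
    qed
  qed (rule \<sigma>F)
qed

text \<open>\<open>D\<close>, \<open>D1\<close> and \<open>D2\<close> are the components witnessing
  that \<open>a\<close>, \<open>b1\<close> and \<open>b2\<close> fail to break their sets.\<close>

lemma paw_breaks:
  assumes b: "E b1 b2" and a: "E a b1" "E a b2" "E a c" and c: "\<not> E c b1" "\<not> E c b2"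
    and D: "connected_in D" "\<forall>v\<in>D. v \<noteq> a \<and> \<not> E v a"
      "\<And>x y. x \<in> D \<Longrightarrow> E x y \<Longrightarrow> y \<noteq> a \<Longrightarrow> \<not> E y a \<Longrightarrow> y \<in> D"
      "\<exists>f\<in>D. E c f" "\<exists>f\<in>D. E b1 f" "\<exists>f\<in>D. E b2 f"
    and D1: "connected_in D1" "c \<in> D1" "\<forall>v\<in>D1. v \<noteq> b1 \<and> \<not> E v b1" "\<exists>f\<in>D1. E b2 f"
    and D2: "connected_in D2" "c \<in> D2" "\<forall>v\<in>D2. v \<noteq> b2 \<and> \<not> E v b2" "\<exists>f\<in>D2. E b1 f"
  shows False
proof -
  define N where "N = {v. v \<noteq> b1 \<and> v \<noteq> b2 \<and> \<not> E v b1 \<and> \<not> E v b2}"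
  have N': "N = {v. v \<noteq> b2 \<and> v \<noteq> b1 \<and> \<not> E v b2 \<and> \<not> E v b1}" by (auto simp: N_def)
  define F where "F = reach N c"
  have b': "E b2 b1" using b sym by blast
  have cN: "c \<in> N" using c b b' by (auto simp: N_def)
  then have cF: "c \<in> F" by (simp add: F_def reach_refl)
  have F: "connected_in F" "\<forall>f\<in>F. f \<noteq> b1 \<and> f \<noteq> b2 \<and> \<not> E f b1 \<and> \<not> E f b2"
    using connected_in_reach reach_subset[of N c] unfolding F_def N_def by blast+
  have aF: "\<exists>f\<in>F. E a f" using a cF by blast
  obtain y2 where y2: "E y2 b2" "\<not> E y2 b1" "y2 \<noteq> b1" "\<exists>f\<in>F. E y2 f"
    unfolding F_def N_def
    by (rule exit_vertex[OF D1(1,2), of b1 b2]) (use D1 c b b' sym in blast)+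
  obtain y1 where y1: "E y1 b1" "\<not> E y1 b2" "y1 \<noteq> b2" "\<exists>f\<in>F. E y1 f"
    unfolding F_def N'
    by (rule exit_vertex[OF D2(1,2), of b2 b1]) (use D2 c b b' sym in blast)+
  have ab: "b1 \<notin> D" "b2 \<notin> D" "a \<notin> D" using D(2) a sym by blast+
  have no_d: "\<not> (E d b1 \<and> E d b2)" if "d \<in> D" "\<exists>f\<in>F. E d f" for d
  proof
    assume d: "E d b1 \<and> E d b2"
    have "a \<noteq> d" "\<not> E a d" using D(2) that sym by blast+
    then show False
      using no_opposite_hubs[OF b a(1,2) _ _ _ _ F aF that(2) y1(1,2) y2(1,2) y1(3) y2(3) y1(4) y2(4)] d
      by blast
  qed
  have "\<exists>v\<in>D. E v b2 \<and> (\<exists>f\<in>F. E v f)"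
    unfolding F_def N_def
    by (rule unreached_side[OF b a cF[unfolded F_def N_def] D(1-4,6) y2(1-3) y2(4)[unfolded F_def N_def]])
  then obtain e2 where e2: "e2 \<in> D" "E e2 b2 \<and> (\<exists>f\<in>F. E e2 f)" by blast
  have "\<exists>v\<in>D. E v b1 \<and> (\<exists>f\<in>F. E v f)"
    unfolding F_def N'
    by (rule unreached_side[OF b' a(2,1,3) cF[unfolded F_def N'] D(1-5) y1(1-3) y1(4)[unfolded F_def N']])
  then obtain e1 where e1: "e1 \<in> D" "E e1 b1 \<and> (\<exists>f\<in>F. E e1 f)" by blast
  obtain ys where ys: "induced_path E ys" "set ys \<subseteq> D"
    "\<forall>y\<in>set ys. (E y b1 \<and> (\<exists>f\<in>F. E y f)) \<longleftrightarrow> y = hd ys"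
    "\<forall>y\<in>set ys. (E y b2 \<and> (\<exists>f\<in>F. E y f)) \<longleftrightarrow> y = last ys"
    by (rule connected_in_path[OF D(1) e1(1) _ e2(1),
          of "\<lambda>y. E y b1 \<and> (\<exists>f\<in>F. E y f)" "\<lambda>y. E y b2 \<and> (\<exists>f\<in>F. E y f)"])
      (use e1 e2 in auto)
  have ne: "ys \<noteq> []" using ys by auto
  have hl: "E (hd ys) b1" "\<exists>f\<in>F. E (hd ys) f" "E (last ys) b2" "\<exists>f\<in>F. E (last ys) f" "hd ys \<in> D" "last ys \<in> D"
    using ys ne hd_in_set[OF ne] last_in_set[OF ne] by blast+
  have hl2: "\<not> E (hd ys) b2" "\<not> E (last ys) b1" using no_d hl by blast+
  then have "hd ys \<noteq> last ys" using hl by auto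
  then obtain z1 \<tau> z2 where z: "ys = z1 # \<tau> @ [z2]"
    by (metis append_butlast_last_id last_ConsL list.collapse list.sel(1) last_tl ne)
  have z': "E z1 b1" "\<not> E z1 b2" "E z2 b2" "\<not> E z2 b1" "\<exists>f\<in>F. E z1 f" "\<exists>f\<in>F. E z2 f" "z1 \<in> D" "z2 \<in> D"
    using hl hl2 z by auto
  have zb: "z1 \<noteq> b2" "z2 \<noteq> b1" using z' ab by auto
  have na: "\<forall>x\<in>set (z1 # \<tau> @ [z2]). \<not> E a x" using D(2) ys(2) z sym by blast
  have \<tau>ne: "\<tau> \<noteq> []" using ys(1) z opposite_ends[OF b z'(1-4) zb] by (auto simp: induced_path_Cons_iff)
  have dist: "distinct (z1 # \<tau> @ [z2])" using ys(1) z by (simp add: induced_path_def)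
  \<comment> \<open>By the choice of \<open>ys\<close>, an inner vertex with a neighbour in
    \<open>F\<close> sees neither \<open>b1\<close> nor \<open>b2\<close>, so it joins
    \<open>F\<close>. Hence membership in \<open>F\<close> is constant along
    \<open>\<tau>\<close>.\<close>
  have in_F: "x \<in> F" if "x \<in> set \<tau>" "\<exists>f\<in>F. E x f" for x
  proof -
    have "x \<noteq> z1" "x \<noteq> z2" "x \<in> D" "x \<in> set ys" using that dist ys(2) z by auto
    then have "\<not> E x b1" "\<not> E x b2" using ys(3,4) that z by auto
    then have "x \<in> N" using ab \<open>x \<in> D\<close> by (auto simp: N_def)
    then show ?thesis using that reach_step[of _ N c x] sym unfolding F_def by blast
  qed
  show False
  proof (cases "set \<tau> \<subseteq> F")
    \<comment> \<open>Now \<open>ys\<close> is itself a path through \<open>F\<close> between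
      private neighbours, so \<open>a\<close> would have to meet it, although \<open>a\<close> has
      no neighbour in \<open>D\<close>.\<close>
    case True
    then have "\<exists>x\<in>set (z1 # \<tau> @ [z2]). E a x"
      using hub_meets_path[OF b a(1,2) F _ _ z'(1-4) ys(1)[unfolded z] _ \<tau>ne] aF by blast
    then show False using na by blast
  next
    case False
    have "successively E \<tau>"
      using induced_path_successively[OF ys(1)] z by (auto simp: successively_Cons successively_append_iff)
    then have "\<forall>x\<in>set \<tau>. x \<notin> F"
      using successively_all[of E \<tau> _ "\<lambda>x. x \<in> F"] False in_F sym by blast
    then have "\<forall>x\<in>set \<tau>. x \<notin> F \<and> (\<forall>f\<in>F. \<not> E f x)" using in_F sym by blast
    then show False
      using no_two_sided_exit[OF b a(1,2) F aF z'(1-4) zb z'(5,6) ys(1)[unfolded z] _ _ na] ab ys(2) z by auto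
  qed
qed

end

section \<open>From the definitions to the locale: components, induced subgraphs, even holes and
  prisms\<close>

lemma (in ugraph) connected_in_component:
  assumes D: "component W E D"
  shows "connected_in D" "D \<subseteq> W" "\<And>x y. x \<in> D \<Longrightarrow> E x y \<Longrightarrow> y \<in> W \<Longrightarrow> y \<in> D"
proof -
  obtain u where u: "u \<in> W" "D = {v. (\<lambda>x y. x \<in> W \<and> y \<in> W \<and> E x y)\<^sup>*\<^sup>* u v}"
    using D by (auto simp: component_def)
  let ?R = "\<lambda>x y. x \<in> W \<and> y \<in> W \<and> E x y"
  have sub: "v \<in> W" if "?R\<^sup>*\<^sup>* u v" for v using that u(1) by (induction rule: rtranclp_induct) auto
  have "v \<in> reach W u" if "?R\<^sup>*\<^sup>* u v" for v using that
    by (induction rule: rtranclp_induct) (use u reach_refl reach_step in blast)+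
  moreover have "?R\<^sup>*\<^sup>* u (last xs)" if "successively E xs" "xs \<noteq> []" "hd xs = u" "set xs \<subseteq> W" for xs
    using that
  proof (induction xs rule: rev_induct)
    case (snoc x xs)
    show ?case
    proof (cases "xs = []")
      case False
      then have "?R\<^sup>*\<^sup>* u (last xs)" "?R (last xs) x"
        using snoc by (auto simp: successively_append_iff)
      then show ?thesis by (simp add: rtranclp.rtrancl_into_rtrancl)
    qed (use snoc in simp)
  qed simp
  ultimately have "D = reach W u" unfolding u(2) reach_def by blast
  then show "connected_in D" "D \<subseteq> W" "\<And>x y. x \<in> D \<Longrightarrow> E x y \<Longrightarrow> y \<in> W \<Longrightarrow> y \<in> D"
    using connected_in_reach reach_subset reach_step by blast+
qed

text \<open>Adjacency in the subgraph induced by \<open>X\<close>, on the whole type: vertices outside \<open>X\<close> are isolated,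
so adjacency statements need no side conditions on membership.\<close>

definition restrict :: "'a set \<Rightarrow> ('a \<Rightarrow> 'a \<Rightarrow> bool) \<Rightarrow> 'a \<Rightarrow> 'a \<Rightarrow> bool" where
  "restrict X E u v \<longleftrightarrow> u \<in> X \<and> v \<in> X \<and> E u v"

text \<open>Each vertex has a neighbour on the path, and adjacency forces it into \<open>X\<close>.
  The length bound matters: a single vertex outside \<open>X\<close> is also an induced path for
  \<open>restrict X E\<close>.\<close>

lemma induced_path_restrict:
  assumes "induced_path (restrict X E) p" "2 \<le> length p"
  shows "set p \<subseteq> X" "induced_path E p"
proof -
  show sub: "set p \<subseteq> X"
  proof
    fix x assume "x \<in> set p"
    then obtain i where i: "i < length p" "x = p!i" by (metis in_set_conv_nth)
    define k where "k = (if i = 0 then 1 else i - 1)"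
    have "k < length p" "i = k + 1 \<or> k = i + 1" using i assms(2) by (auto simp: k_def)
    then have "restrict X E (p!i) (p!k)" using assms(1) i unfolding induced_path_def by blast
    then show "x \<in> X" using i by (simp add: restrict_def)
  qed
  have "p!i \<in> X" if "i < length p" for i using sub that nth_mem by blast
  then show "induced_path E p" using assms(1) by (simp add: induced_path_def restrict_def)
qed

lemma chromatic_number_colouring:
  assumes "finite H" "\<And>v. \<not> E v v"
  shows "\<exists>f. proper_colouring H E (chromatic_number H E) f"
proof -
  obtain f :: "'a \<Rightarrow> nat" where "bij_betw f H {0..<card H}"
    using ex_bij_betw_finite_nat[OF assms(1)] by blast
  then have "proper_colouring H E (card H) f"
    using assms(2) by (auto simp: proper_colouring_def bij_betw_def inj_on_def)
  then have "\<exists>f. proper_colouring H E (card H) f" by blast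
  then show ?thesis unfolding chromatic_number_def by (rule LeastI)
qed

lemma clique_number_le:
  assumes "finite H" "\<And>K. K \<subseteq> H \<Longrightarrow> clique E K \<Longrightarrow> card K \<le> n"
  shows "clique_number H E \<le> n"
  unfolding clique_number_def
proof (rule Max.boundedI)
  have "{card K |K. K \<subseteq> H \<and> clique E K} \<subseteq> card ` Pow H" by auto
  then show "finite {card K |K. K \<subseteq> H \<and> clique E K}" using assms by (meson finite_Pow_iff finite_imageI finite_subset)
  have "card {} \<in> {card K |K. K \<subseteq> H \<and> clique E K}" by (auto simp: clique_def intro!: exI[of _ "{}"])
  then show "{card K |K. K \<subseteq> H \<and> clique E K} \<noteq> {}" by blast
qed (use assms in auto)

text \<open>The hole has no triangle, so perfection colours it with two colours. They alternate
  along \<open>p\<close>, and both ends of \<open>p\<close> differ in colour from \<open>x\<close>,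
  so the ends agree and the length is odd.\<close>

lemma perfect_hole_even:
  assumes G: "simple_graph V E" and perf: "perfect V E"
    and p: "induced_path E p" "set p \<subseteq> V" "3 \<le> length p"
    and x: "x \<in> V" "x \<notin> set p" "\<And>y. y \<in> set p \<Longrightarrow> E x y \<longleftrightarrow> y = hd p \<or> y = last p"
  shows "odd (length p)"
proof (rule ccontr)
  assume "\<not> odd (length p)"
  then have n: "even (length p)" "4 \<le> length p" using p(3) by presburger+
  let ?H = "insert x (set p)" and ?n = "length p"
  have symE: "E u v \<Longrightarrow> E v u" and irr: "\<not> E v v" for u v using G by (auto simp: simple_graph_def)
  have dist: "distinct p" and ne: "p \<noteq> []" using p by (auto simp: induced_path_def)
  have adj: "E (p!i) (p!j) \<longleftrightarrow> i = j + 1 \<or> j = i + 1" if "i < ?n" "j < ?n" for i j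
    using p(1) that by (simp add: induced_path_def)
  have xadj: "E x (p!i) \<longleftrightarrow> i = 0 \<or> i = ?n - 1" if "i < ?n" for i
    using x(3)[of "p!i"] that ne dist by (simp add: hd_conv_nth last_conv_nth nth_eq_iff_index_eq)
  \<comment> \<open>Any triangle has at least two vertices on \<open>p\<close>, so only the first
    one needs to range over \<open>x\<close> as well.\<close>
  have no_tri: False if abc: "a \<in> ?H" "b \<in> set p" "c \<in> set p" "E a b" "E a c" "E b c" for a b c
  proof -
    obtain j k where jk: "j < ?n" "b = p!j" "k < ?n" "c = p!k" using abc by (metis in_set_conv_nth)
    show False
    proof (cases "a = x")
      case True
      then show False using jk abc xadj[of j] xadj[of k] adj[of j k] n by auto
    next
      case False
      then obtain i where "i < ?n" "a = p!i" using abc by (metis in_set_conv_nth insertE)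
      then show False using jk abc adj[of i j] adj[of i k] adj[of j k] by auto
    qed
  qed
  have "clique_number ?H E \<le> 2"
  proof (rule clique_number_le)
    fix K assume K: "K \<subseteq> ?H" "clique E K"
    show "card K \<le> 2"
    proof (rule ccontr)
      assume "\<not> card K \<le> 2"
      then obtain T where "T \<subseteq> K" "card T = 3" using obtain_subset_with_card_n[of 3 K] by auto
      then obtain a b c where T: "a \<in> K" "b \<in> K" "c \<in> K" "a \<noteq> b" "b \<noteq> c" "a \<noteq> c"
        by (auto simp: card_3_iff)
      then have e: "E a b" "E a c" "E b c" "E b a" "E c a" "E c b" using K(2) by (auto simp: clique_def)
      have H: "a \<in> ?H" "b \<in> ?H" "c \<in> ?H" using T K by auto
      then consider "b \<in> set p" "c \<in> set p" | "a \<in> set p" "c \<in> set p" | "a \<in> set p" "b \<in> set p"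
        using T by auto
      then show False using no_tri H e by cases blast+
    qed
  qed simp
  moreover have "chromatic_number ?H E = clique_number ?H E"
    using perf p(2) x(1) by (simp add: perfect_def)
  moreover obtain f where f: "proper_colouring ?H E (chromatic_number ?H E) f"
    using chromatic_number_colouring[of ?H E] irr by auto
  ultimately have lt: "f v < 2" if "v \<in> ?H" for v
    using that by (metis proper_colouring_def order_less_le_trans)
  have ne_col: "f u \<noteq> f v" if "u \<in> ?H" "v \<in> ?H" "E u v" for u v
    using f that by (auto simp: proper_colouring_def)
  have "f (p!i) = f (p!0) \<longleftrightarrow> even i" if "i < ?n" for i
    using that
  proof (induction i)
    case (Suc i)
    have "f (p!i) \<noteq> f (p!Suc i)"
      using Suc.prems adj[of i "Suc i"] by (intro ne_col) auto
    moreover have "f (p!i) < 2" "f (p!Suc i) < 2" "f (p!0) < 2"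
      using Suc.prems ne by (auto intro!: lt)
    ultimately have "f (p!Suc i) = f (p!0) \<longleftrightarrow> f (p!i) \<noteq> f (p!0)" by linarith
    then show ?case using Suc by simp
  qed simp
  then have "f (p!(?n - 1)) \<noteq> f (p!0)" using n ne by simp
  moreover have "f x \<noteq> f (p!0)" "f x \<noteq> f (p!(?n - 1))"
    using xadj[of 0] xadj[of "?n - 1"] ne by (intro ne_col; simp)+
  moreover have "f x < 2" "f (p!0) < 2" "f (p!(?n - 1)) < 2" using ne by (auto intro!: lt)
  ultimately show False by linarith
qed

lemma has_prismI:
  assumes p: "induced_path E p" "induced_path E q" "induced_path E r"
    and V: "set p \<subseteq> V" "set q \<subseteq> V" "set r \<subseteq> V"
    and disj: "set p \<inter> set q = {}" "set p \<inter> set r = {}" "set q \<inter> set r = {}"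
    and len: "2 \<le> length p" "2 \<le> length q" "2 \<le> length r"
    and pq: "\<And>x y. x \<in> set p \<Longrightarrow> y \<in> set q \<Longrightarrow> E x y \<longleftrightarrow> x = hd p \<and> y = hd q \<or> x = last p \<and> y = last q"
    and pr: "\<And>x y. x \<in> set p \<Longrightarrow> y \<in> set r \<Longrightarrow> E x y \<longleftrightarrow> x = hd p \<and> y = hd r \<or> x = last p \<and> y = last r"
    and qr: "\<And>x y. x \<in> set q \<Longrightarrow> y \<in> set r \<Longrightarrow> E x y \<longleftrightarrow> x = hd q \<and> y = hd r \<or> x = last q \<and> y = last r"
    and sym: "\<And>x y. E x y \<Longrightarrow> E y x"
  shows "has_prism V E"
proof -
  define P where "P i = (if i = 0 then p else if i = 1 then q else r)" for i :: nat
  have P: "P 0 = p" "P 1 = q" "P 2 = r" "P (Suc 0) = q" by (simp_all add: P_def)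
  have three: "i = 0 \<or> i = 1 \<or> i = 2" if "i < 3" for i :: nat using that by auto
  have ne: "p \<noteq> []" "q \<noteq> []" "r \<noteq> []" using len by auto
  note mem = hd_in_set[OF ne(1)] last_in_set[OF ne(1)] hd_in_set[OF ne(2)] last_in_set[OF ne(2)]
    hd_in_set[OF ne(3)] last_in_set[OF ne(3)]
  have hl: "hd z \<noteq> last z" if "induced_path E z" "2 \<le> length z" for z
    using that by (cases z) (auto simp: induced_path_def)
  have A: "\<forall>i<3. induced_path E (P i) \<and> set (P i) \<subseteq> V"
    using three P p V by metis
  have B: "\<forall>i<3. \<forall>j<3. i \<noteq> j \<longrightarrow> set (P i) \<inter> set (P j) = {}"
    using three P disj by (metis Int_commute)
  have "hd (P i) \<noteq> last (P j)" if "i < 3" "j < 3" for i j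
    using three[OF that(1)] three[OF that(2)] disj mem hl[OF p(1) len(1)] hl[OF p(2) len(2)] hl[OF p(3) len(3)]
    by (elim disjE) (auto simp: P)
  then have C: "{hd (P i) | i. i < 3} \<inter> {last (P i) | i. i < 3} = {}" by blast
  have e: "E (hd p) (hd q)" "E (last p) (last q)" "E (hd p) (hd r)" "E (last p) (last r)" "E (hd q) (hd r)" "E (last q) (last r)"
    using pq pr qr mem by blast+
  have D: "\<forall>i<3. \<forall>j<3. i \<noteq> j \<longrightarrow> E (hd (P i)) (hd (P j)) \<and> E (last (P i)) (last (P j))"
  proof (intro allI impI)
    fix i j :: nat assume "i < 3" "j < 3" "i \<noteq> j"
    then show "E (hd (P i)) (hd (P j)) \<and> E (last (P i)) (last (P j))"
      using three[OF \<open>i < 3\<close>] three[OF \<open>j < 3\<close>] e e[THEN sym] by (elim disjE) (auto simp: P)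
  qed
  have "\<forall>i<3. \<forall>j<3. i < j \<longrightarrow> (\<forall>x\<in>set (P i). \<forall>y\<in>set (P j).
          E x y \<longrightarrow> (x = hd (P i) \<and> y = hd (P j)) \<or> (x = last (P i) \<and> y = last (P j)))"
  proof (intro allI impI ballI)
    fix i j :: nat and x y assume ij: "i < 3" "j < 3" "i < j" and xy: "x \<in> set (P i)" "y \<in> set (P j)" "E x y"
    then consider "i = 0" "j = 1" | "i = 0" "j = 2" | "i = 1" "j = 2" by linarith
    then show "(x = hd (P i) \<and> y = hd (P j)) \<or> (x = last (P i) \<and> y = last (P j))"
      using xy pq[of x y] pr[of x y] qr[of x y] by cases (auto simp: P)
  qed
  then show ?thesis unfolding has_prism_def using A B C D by blast
qed

lemma prism_free_restrict:
  assumes G: "simple_graph V E" and C4: "C4_free V E" and pf: "prism_free V E" and perf: "perfect V E"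
    and X: "X \<subseteq> V"
  shows "prism_free_graph (restrict X E)"
proof
  let ?E = "restrict X E"
  have symE: "E u v \<Longrightarrow> E v u" and irr: "\<not> E v v" for u v using G by (auto simp: simple_graph_def)
  show "?E y x" if "?E x y" for x y using that symE by (auto simp: restrict_def)
  show "\<not> ?E x x" for x using irr by (simp add: restrict_def)
  show "odd (length p)" if p: "induced_path ?E p" "x \<notin> set p" "3 \<le> length p"
    and adj: "\<And>y. y \<in> set p \<Longrightarrow> ?E x y \<longleftrightarrow> y = hd p \<or> y = last p" for p x
  proof -
    have pX: "set p \<subseteq> X" "induced_path E p" using induced_path_restrict[OF p(1)] p(3) by auto
    have "hd p \<in> set p" using p(3) by (cases p) auto
    then have "?E x (hd p)" using adj by blast
    then have xX: "x \<in> X" by (simp add: restrict_def)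
    show ?thesis
      by (rule perfect_hole_even[OF G perf pX(2) _ p(3) _ p(2)])
        (use pX xX X adj in \<open>auto simp: restrict_def\<close>)
  qed
  show "?E a c \<or> ?E b d" if "?E a b" "?E b c" "?E c d" "?E d a" "a \<noteq> c" "b \<noteq> d" for a b c d
  proof -
    have "a \<noteq> b" "b \<noteq> c" "c \<noteq> d" "d \<noteq> a" using that irr by (auto simp: restrict_def)
    then have "distinct [a, b, c, d]" using that by auto
    moreover have "a \<in> V" "b \<in> V" "c \<in> V" "d \<in> V" "E a b" "E b c" "E c d" "E d a"
      using that X by (auto simp: restrict_def)
    ultimately have "E a c \<or> E b d" using C4 unfolding C4_free_def by blast
    then show ?thesis using that by (auto simp: restrict_def)
  qed
  show False if p: "induced_path ?E p" "induced_path ?E q" "induced_path ?E r"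
    and disj: "set p \<inter> set q = {}" "set p \<inter> set r = {}" "set q \<inter> set r = {}"
    and len: "2 \<le> length p" "2 \<le> length q" "2 \<le> length r"
    and pq: "\<And>x y. x \<in> set p \<Longrightarrow> y \<in> set q \<Longrightarrow> ?E x y \<longleftrightarrow> x = hd p \<and> y = hd q \<or> x = last p \<and> y = last q"
    and pr: "\<And>x y. x \<in> set p \<Longrightarrow> y \<in> set r \<Longrightarrow> ?E x y \<longleftrightarrow> x = hd p \<and> y = hd r \<or> x = last p \<and> y = last r"
    and qr: "\<And>x y. x \<in> set q \<Longrightarrow> y \<in> set r \<Longrightarrow> ?E x y \<longleftrightarrow> x = hd q \<and> y = hd r \<or> x = last q \<and> y = last r"
    for p q r
  proof -
    note P = induced_path_restrict[OF p(1) len(1)] induced_path_restrict[OF p(2) len(2)]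
      induced_path_restrict[OF p(3) len(3)]
    have eq: "?E x y \<longleftrightarrow> E x y" if "x \<in> X" "y \<in> X" for x y using that by (simp add: restrict_def)
    have "has_prism V E"
    proof (rule has_prismI[OF P(2,4,6) _ _ _ disj len])
      show "E x y \<longleftrightarrow> x = hd p \<and> y = hd q \<or> x = last p \<and> y = last q" if "x \<in> set p" "y \<in> set q" for x y
        using pq[OF that] eq[of x y] that P by blast
      show "E x y \<longleftrightarrow> x = hd p \<and> y = hd r \<or> x = last p \<and> y = last r" if "x \<in> set p" "y \<in> set r" for x y
        using pr[OF that] eq[of x y] that P by blast
      show "E x y \<longleftrightarrow> x = hd q \<and> y = hd r \<or> x = last q \<and> y = last r" if "x \<in> set q" "y \<in> set r" for x y
        using qr[OF that] eq[of x y] that P by blast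
    qed (use P X symE in auto)
    then show False using pf by (simp add: prism_free_def)
  qed
qed

text \<open>Under the side conditions built into \<open>breaks\<close>, its failure is a single
  component touching all of \<open>Y\<close>. The component is described by adjacency in
  \<open>restrict X E\<close>, as the locale lemmas need.\<close>

lemma not_breaksE:
  assumes X: "ugraph (restrict X E)" and Y: "Y \<subseteq> X" "x \<in> X - Y" and nb: "\<not> breaks X E x Y"
  obtains D where "ugraph.connected_in (restrict X E) D" "\<forall>v\<in>D. v \<noteq> x \<and> \<not> restrict X E v x"
    "\<And>u v. u \<in> D \<Longrightarrow> restrict X E u v \<Longrightarrow> v \<noteq> x \<Longrightarrow> \<not> restrict X E v x \<Longrightarrow> v \<in> D"
    "\<forall>y\<in>Y. y \<in> D \<or> (\<exists>f\<in>D. restrict X E y f)"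
proof -
  interpret ugraph "restrict X E" by (rule X)
  let ?W = "X - closed_nbhd X E {x}"
  obtain D where D: "component ?W E D" "Y \<subseteq> closed_nbhd X E D"
    using nb Y by (auto simp: breaks_def)
  have "(\<lambda>u v. u \<in> ?W \<and> v \<in> ?W \<and> E u v) = (\<lambda>u v. u \<in> ?W \<and> v \<in> ?W \<and> restrict X E u v)"
    by (auto simp: restrict_def fun_eq_iff)
  then have D': "component ?W (restrict X E) D" using D(1) by (simp add: component_def)
  note comp = connected_in_component[OF D']
  have W: "v \<in> ?W \<longleftrightarrow> v \<in> X \<and> v \<noteq> x \<and> \<not> restrict X E v x" for v
    using Y by (auto simp: closed_nbhd_def restrict_def)
  show ?thesis
  proof (rule that[OF comp(1)])
    show "\<forall>v\<in>D. v \<noteq> x \<and> \<not> restrict X E v x" using comp(2) W by blast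
    show "v \<in> D" if "u \<in> D" "restrict X E u v" "v \<noteq> x" "\<not> restrict X E v x" for u v
      using comp(3)[OF that(1,2)] W that by (auto simp: restrict_def)
    show "\<forall>y\<in>Y. y \<in> D \<or> (\<exists>f\<in>D. restrict X E y f)"
      using D(2) comp(2) by (auto simp: closed_nbhd_def restrict_def)
  qed
qed

theorem theorem5p7:
  fixes V :: "'a set" and E :: "'a \<Rightarrow> 'a \<Rightarrow> bool"
  assumes "simple_graph V E"
    and "C4_free V E"
    and "prism_free V E"
    and "perfect V E"
  shows "paw_friendly V E"
  unfolding paw_friendly_def
proof (intro conjI allI impI ballI)
  show "perfect V E" by fact
  fix X c a b1 b2
  assume X: "X \<subseteq> V" and mem: "c \<in> X" "a \<in> X" "b1 \<in> X" "b2 \<in> X"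
    and paw: "distinct [c, a, b1, b2] \<and> E a b1 \<and> E a b2 \<and> E b1 b2 \<and> E a c \<and> \<not> E c b1 \<and> \<not> E c b2"
  let ?E = "restrict X E"
  interpret prism_free_graph ?E using prism_free_restrict assms X .
  have G: "ugraph ?E" by unfold_locales
  have e: "?E b1 b2" "?E a b1" "?E a b2" "?E a c" "\<not> ?E c b1" "\<not> ?E c b2"
    using paw mem by (auto simp: restrict_def)
  have e': "?E b2 b1" "?E b1 a" "?E b2 a" "?E c a" using e sym by blast+
  show "breaks X E a {c, b1, b2} \<or> breaks X E b1 {c, b2} \<or> breaks X E b2 {c, b1}"
  proof (rule ccontr)
    assume "\<not> ?thesis"
    then have nb: "\<not> breaks X E a {c, b1, b2}" "\<not> breaks X E b1 {c, b2}" "\<not> breaks X E b2 {c, b1}" by auto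
    obtain D where D: "connected_in D" "\<forall>v\<in>D. v \<noteq> a \<and> \<not> ?E v a"
      "\<And>u v. u \<in> D \<Longrightarrow> ?E u v \<Longrightarrow> v \<noteq> a \<Longrightarrow> \<not> ?E v a \<Longrightarrow> v \<in> D"
      "\<forall>y\<in>{c, b1, b2}. y \<in> D \<or> (\<exists>f\<in>D. ?E y f)"
      by (rule not_breaksE[OF G _ _ nb(1)]) (use mem paw in auto)
    obtain D1 where D1: "connected_in D1" "\<forall>v\<in>D1. v \<noteq> b1 \<and> \<not> ?E v b1"
      "\<And>u v. u \<in> D1 \<Longrightarrow> ?E u v \<Longrightarrow> v \<noteq> b1 \<Longrightarrow> \<not> ?E v b1 \<Longrightarrow> v \<in> D1"
      "\<forall>y\<in>{c, b2}. y \<in> D1 \<or> (\<exists>f\<in>D1. ?E y f)"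
      by (rule not_breaksE[OF G _ _ nb(2)]) (use mem paw in auto)
    obtain D2 where D2: "connected_in D2" "\<forall>v\<in>D2. v \<noteq> b2 \<and> \<not> ?E v b2"
      "\<And>u v. u \<in> D2 \<Longrightarrow> ?E u v \<Longrightarrow> v \<noteq> b2 \<Longrightarrow> \<not> ?E v b2 \<Longrightarrow> v \<in> D2"
      "\<forall>y\<in>{c, b1}. y \<in> D2 \<or> (\<exists>f\<in>D2. ?E y f)"
      by (rule not_breaksE[OF G _ _ nb(3)]) (use mem paw in auto)
    \<comment> \<open>\<open>c\<close>, \<open>b1\<close> and \<open>b2\<close> are neighbours of
      \<open>a\<close>, so they lie outside \<open>D\<close> and have neighbours in it. In contrast,
      \<open>c\<close> sees neither \<open>b1\<close> nor \<open>b2\<close> and therefore belongs to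
      \<open>D1\<close> and \<open>D2\<close> themselves.\<close>
    have Dn: "\<exists>f\<in>D. ?E c f" "\<exists>f\<in>D. ?E b1 f" "\<exists>f\<in>D. ?E b2 f" using D(2,4) e' by auto
    have c1: "c \<in> D1" using D1(3)[of _ c] D1(4) e paw sym by auto
    have c2: "c \<in> D2" using D2(3)[of _ c] D2(4) e paw sym by auto
    have n1: "\<exists>f\<in>D1. ?E b2 f" "\<exists>f\<in>D2. ?E b1 f" using D1(2,4) D2(2,4) e e' by auto
    show False
      by (rule paw_breaks[OF e(1-6) D(1,2,3) Dn D1(1) c1 D1(2) n1(1) D2(1) c2 D2(2) n1(2)])
  qed
qed

end
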